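(* Let $\Omega\subset\{1,\dots,N\}$ with $|\Omega|=K$ be a common support, and let $x_j\in\mathbb{R}^N$, $j=1,\dots,J$, be signals supported on $\Omega$ whose coefficients $x_j(n)$, $n\in\Omega$, $1\le j\le J$, are i.i.d. Gaussian random variables. Let $y_j=\Phi_jx_j$ with $\Phi_j$ an $M_j\times N$ matrix. Then: 1. If the measurement matrices $\Phi_j$ contain i.i.d. Gaussian entries and $M_j=K$ for every $j$, then Trivial Pursuit recovers all signals of the ensemble $\{x_j\}$ with probability approaching one as $J\to\infty$. 2. If for some $j$ the measurement matrix $\Phi_j$ has $M_j<K$ rows, then with probability one the signal $x_j$ cannot be uniquely recovered by any algorithm, for any value of $J$; that is, for every $J$, with probability one there exists another ensemble $\{x_i'\}$ of signals sharing a common support of size $K$, with $x_j'\neq x_j$ and $\Phi_ix_i'=y_i$ for all $i=1,\dots,J$.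
   Context: This is the JSM-2 (common sparse supports) model, with signals sparse in the canonical basis: all signals share the same support but have different nonzero coefficients. $N$ and $K$ are fixed as $J\to\infty$. Trivial Pursuit (TP): let $\phi_{j,n}$ be the $n$-th column of $\Phi_j$. Compute $\xi_n=\frac1J\sum_{j=1}^J\langle y_j,\phi_{j,n}\rangle^2$ for $n\in\{1,\dots,N\}$ and let $\widehat\Omega$ be the set of indices having one of the $K$ largest values $\xi_n$. Signal recovery with TP consists of then solving, for each $j$, the linear system $y_j=\Phi_{j,\widehat\Omega}v_j$ (with $\Phi_{j,\widehat\Omega}$ the submatrix of $\Phi_j$ of columns indexed by $\widehat\Omega$) and setting the estimate $\widehat x_j$ equal to $v_j$ on $\widehat\Omega$ and zero elsewhere. Gaussian variables are zero-mean with positive variance (with a common variance for all coefficients, and a common variance for all matrix entries); the matrices $\Phi_j$ are independent across $j$ and independent of the signals. *)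

theory Defs
  imports "HOL-Probability.Probability"
begin

text \<open>
  A vector in \<open>\<real>\<^sup>N\<close> is a function \<^typ>\<open>nat \<Rightarrow> real\<close> vanishing outside \<open>{1..N}\<close>, and an
  \<open>M \<times> N\<close> matrix is a function \<^typ>\<open>nat \<Rightarrow> nat \<Rightarrow> real\<close> (row, column) of which only the values on
  \<open>{1..M} \<times> {1..N}\<close> are used. The number of rows may differ from sensor to sensor.
\<close>

definition measure_vec :: "nat \<Rightarrow> (nat \<Rightarrow> nat \<Rightarrow> real) \<Rightarrow> (nat \<Rightarrow> real) \<Rightarrow> nat \<Rightarrow> real" where
  "measure_vec N A x m = (\<Sum>n=1..N. A m n * x n)"

definition tp_statistic ::
  "nat \<Rightarrow> (nat \<Rightarrow> nat) \<Rightarrow> (nat \<Rightarrow> nat \<Rightarrow> nat \<Rightarrow> real) \<Rightarrow> (nat \<Rightarrow> nat \<Rightarrow> real) \<Rightarrow> nat \<Rightarrow> real" where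
  "tp_statistic J M \<Phi> y n = 1 / real J * (\<Sum>j=1..J. (\<Sum>m=1..M j. y j m * \<Phi> j m n)\<^sup>2)"

text \<open>
  A set of \<open>K\<close> indices carrying the \<open>K\<close> largest values of \<open>\<xi>\<close>. This is a relation because ties
  may leave several choices; it is satisfied by some \<open>S\<close> whenever \<open>K \<le> N\<close>.
\<close>

definition tp_support :: "nat \<Rightarrow> nat \<Rightarrow> (nat \<Rightarrow> real) \<Rightarrow> nat set \<Rightarrow> bool" where
  "tp_support N K \<xi> S \<longleftrightarrow>
     S \<subseteq> {1..N} \<and> card S = K \<and> (\<forall>n\<in>S. \<forall>k\<in>{1..N} - S. \<xi> k \<le> \<xi> n)"

text \<open>
  All estimates obtained from solutions of the system restricted to the columns in \<open>S\<close>; a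
  singleton iff the system has exactly one solution.
\<close>

definition tp_estimates ::
  "nat \<Rightarrow> (nat \<Rightarrow> nat \<Rightarrow> real) \<Rightarrow> (nat \<Rightarrow> real) \<Rightarrow> nat set \<Rightarrow> (nat \<Rightarrow> real) set" where
  "tp_estimates M A y S =
     {(\<lambda>n. if n \<in> S then v n else 0) | v. \<forall>m\<in>{1..M}. y m = (\<Sum>n\<in>S. A m n * v n)}"

text \<open>Success is required for every way of breaking ties in the choice of the support.\<close>

definition tp_recovers ::
  "nat \<Rightarrow> nat \<Rightarrow> nat \<Rightarrow> (nat \<Rightarrow> nat) \<Rightarrow> (nat \<Rightarrow> nat \<Rightarrow> nat \<Rightarrow> real) \<Rightarrow> (nat \<Rightarrow> nat \<Rightarrow> real) \<Rightarrow> bool" where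
  "tp_recovers J N K M \<Phi> x \<longleftrightarrow>
     (let y = (\<lambda>j. measure_vec N (\<Phi> j) (x j)) in
      \<forall>S. tp_support N K (tp_statistic J M \<Phi> y) S \<longrightarrow>
          (\<forall>j\<in>{1..J}. tp_estimates (M j) (\<Phi> j) (y j) S = {x j}))"

definition iid_gaussian :: "'a measure \<Rightarrow> real \<Rightarrow> 'i set \<Rightarrow> ('i \<Rightarrow> 'a \<Rightarrow> real) \<Rightarrow> bool" where
  "iid_gaussian P \<sigma> I X \<longleftrightarrow>
     prob_space.indep_vars P (\<lambda>_. borel) X I \<and>
     (\<forall>i\<in>I. distributed P lborel (X i) (normal_density 0 \<sigma>))"

text \<open>
  In the mutual independence below, index \<^const>\<open>None\<close> stands for the array of all signal
  coefficients and index \<open>Some j\<close> for the \<open>j\<close>-th matrix, each taken as one random element. No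
  distribution is imposed on the matrices; constant (deterministic) matrices are allowed.
\<close>

definition jsm2_ensemble ::
  "'a measure \<Rightarrow> nat \<Rightarrow> nat \<Rightarrow> nat set \<Rightarrow> real \<Rightarrow> (nat \<Rightarrow> nat) \<Rightarrow>
   (nat \<Rightarrow> 'a \<Rightarrow> nat \<Rightarrow> real) \<Rightarrow> (nat \<Rightarrow> 'a \<Rightarrow> nat \<Rightarrow> nat \<Rightarrow> real) \<Rightarrow> bool" where
  "jsm2_ensemble P J N \<Omega> \<sigma> M x \<Phi> \<longleftrightarrow>
     prob_space P \<and>
     (\<forall>j\<in>{1..J}. \<forall>\<omega>\<in>space P. \<forall>n. n \<notin> \<Omega> \<longrightarrow> x j \<omega> n = 0) \<and>
     iid_gaussian P \<sigma> ({1..J} \<times> \<Omega>) (\<lambda>(j, n) \<omega>. x j \<omega> n) \<and>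
     prob_space.indep_vars P
       (\<lambda>i. case i of
          None \<Rightarrow> PiM ({1..J} \<times> \<Omega>) (\<lambda>_. borel)
        | Some j \<Rightarrow> PiM ({1..M j} \<times> {1..N}) (\<lambda>_. borel))
       (\<lambda>i \<omega>. case i of
          None \<Rightarrow> (\<lambda>(j, n)\<in>{1..J} \<times> \<Omega>. x j \<omega> n)
        | Some j \<Rightarrow> (\<lambda>(m, n)\<in>{1..M j} \<times> {1..N}. \<Phi> j \<omega> m n))
       (insert None (Some ` {1..J}))"

end

theory Submission
  imports Defs "Jordan_Normal_Form.Determinant"
begin

text \<open>
  Part 1. The difference of the statistic \<open>\<xi>\<^sub>n - \<xi>\<^sub>k\<close> with \<open>n \<in> \<Omega>\<close> and \<open>k \<notin> \<Omega>\<close> is an average over \<open>j\<close> of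
  independent variables. Their mean is at least \<open>2 \<sigma>\<^sup>2 M \<tau>\<^sup>4 > 0\<close> and their second moment is bounded
  uniformly in \<open>j\<close> and \<open>J\<close>, so by Chebyshev's inequality and a union bound over \<open>(n, k)\<close> all averages are
  positive with probability \<open>1 - O(1/J)\<close>, and then Trivial Pursuit selects exactly \<open>\<Omega>\<close>. The square systems on
  \<open>\<Omega>\<close> are almost surely invertible.

  Part 2. \<open>\<Phi>\<^sub>j\<close> restricted to the columns in \<open>\<Omega>\<close> has a nonzero kernel vector \<open>h\<close>. Almost surely all
  coefficients on \<open>\<Omega>\<close> are nonzero, and replacing \<open>x\<^sub>j\<close> by \<open>x\<^sub>j + t h\<close> keeps the support for all but
  finitely many \<open>t\<close>.
\<close>

section \<open>Moments and independence\<close>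

text \<open>Every \<open>J\<close> comes with its own probability space, so the averages form a
  triangular array and an almost sure law of large numbers along \<open>J\<close> does not apply.
  Hence an estimate for fixed \<open>J\<close> whose constants depend only on \<open>N\<close>,
  \<open>K\<close>, \<open>\<sigma>\<close> and \<open>\<tau>\<close>; crude moment bounds suffice,
  since only the factor \<open>1 / J\<close> matters in the limit. The means differ because a
  centred Gaussian has fourth moment \<open>3 * \<tau> ^ 4\<close>, three times the square of its
  variance, and such fourth powers occur only when a column is paired with itself. The obstacle is
  independence. The ensemble is given as independent blocks with independent entries inside each,
  while the estimates group the scalars in other ways: one column against another, the coefficients
  of a signal against a matrix, one sensor against the rest. All scalars are therefore merged into
  one independent family, from which disjoint groups are split off as needed. A success probability
  also presupposes that the recovery event, which quantifies over all tie breaks and all solutions,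
  is measurable.\<close>

definition all_moments :: "'a measure \<Rightarrow> ('a \<Rightarrow> real) \<Rightarrow> bool" where
  "all_moments M X \<longleftrightarrow> X \<in> borel_measurable M \<and> (\<forall>p. integrable M (\<lambda>\<omega>. \<bar>X \<omega>\<bar> ^ p))"

lemma all_moments_measurable: "all_moments M X \<Longrightarrow> X \<in> borel_measurable M"
  by (simp add: all_moments_def)

lemma all_moments_integrable:
  assumes "all_moments M X"
  shows "integrable M X"
proof -
  have "integrable M (\<lambda>\<omega>. \<bar>X \<omega>\<bar> ^ 1)"
    using assms unfolding all_moments_def by blast
  then show ?thesis
    using assms by (simp add: all_moments_def integrable_abs_iff)
qed

text \<open>Moments of order \<open>2 * p\<close> of the factors pay for order \<open>p\<close> of
  the product. Together with closure under sums, this makes every polynomial in the Gaussian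
  variables integrable by structural rules alone.\<close>

lemma all_moments_mult:
  assumes X: "all_moments M X" and Y: "all_moments M Y"
  shows "all_moments M (\<lambda>\<omega>. X \<omega> * Y \<omega>)"
proof -
  have [measurable]: "X \<in> borel_measurable M" "Y \<in> borel_measurable M"
    using X Y by (auto simp: all_moments_def)
  have "integrable M (\<lambda>\<omega>. \<bar>X \<omega> * Y \<omega>\<bar> ^ p)" for p
  proof (rule Bochner_Integration.integrable_bound)
    show "integrable M (\<lambda>\<omega>. \<bar>X \<omega>\<bar> ^ (2 * p) + \<bar>Y \<omega>\<bar> ^ (2 * p))"
      using X Y by (auto simp: all_moments_def)
    have "a * b \<le> a\<^sup>2 + b\<^sup>2" if "a \<ge> 0" "b \<ge> 0" for a b :: real
      using sum_squares_bound[of a b] mult_nonneg_nonneg[OF that] by linarith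
    from this[of "\<bar>X \<omega>\<bar> ^ p" "\<bar>Y \<omega>\<bar> ^ p" for \<omega>]
    show "AE \<omega> in M. norm (\<bar>X \<omega> * Y \<omega>\<bar> ^ p) \<le> norm (\<bar>X \<omega>\<bar> ^ (2 * p) + \<bar>Y \<omega>\<bar> ^ (2 * p))"
      by (simp add: abs_mult power_mult_distrib power_even_eq)
  qed simp
  then show ?thesis
    by (simp add: all_moments_def)
qed

lemma all_moments_add:
  assumes X: "all_moments M X" and Y: "all_moments M Y"
  shows "all_moments M (\<lambda>\<omega>. X \<omega> + Y \<omega>)"
proof -
  have [measurable]: "X \<in> borel_measurable M" "Y \<in> borel_measurable M"
    using X Y by (auto simp: all_moments_def)
  have "integrable M (\<lambda>\<omega>. \<bar>X \<omega> + Y \<omega>\<bar> ^ p)" for p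
  proof (rule Bochner_Integration.integrable_bound)
    show "integrable M (\<lambda>\<omega>. 2 ^ p * (\<bar>X \<omega>\<bar> ^ p + \<bar>Y \<omega>\<bar> ^ p))"
      using X Y by (auto simp: all_moments_def)
    have "\<bar>a + b\<bar> ^ p \<le> 2 ^ p * (\<bar>a\<bar> ^ p + \<bar>b\<bar> ^ p)" for a b :: real
    proof -
      have "\<bar>a + b\<bar> ^ p \<le> (2 * max \<bar>a\<bar> \<bar>b\<bar>) ^ p"
        by (intro power_mono) auto
      also have "\<dots> = 2 ^ p * max \<bar>a\<bar> \<bar>b\<bar> ^ p"
        by (simp add: power_mult_distrib)
      also have "max \<bar>a\<bar> \<bar>b\<bar> ^ p \<le> \<bar>a\<bar> ^ p + \<bar>b\<bar> ^ p"
        by (simp add: max_def)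
      finally show ?thesis by simp
    qed
    then show "AE \<omega> in M. norm (\<bar>X \<omega> + Y \<omega>\<bar> ^ p) \<le> norm (2 ^ p * (\<bar>X \<omega>\<bar> ^ p + \<bar>Y \<omega>\<bar> ^ p))"
      by (simp add: abs_mult)
  qed simp
  then show ?thesis
    by (simp add: all_moments_def)
qed

lemma (in prob_space) all_moments_const: "all_moments M (\<lambda>_. c)"
  by (simp add: all_moments_def)

lemma (in prob_space) all_moments_diff:
  assumes X: "all_moments M X" and Y: "all_moments M Y"
  shows "all_moments M (\<lambda>\<omega>. X \<omega> - Y \<omega>)"
  using all_moments_add[OF X all_moments_mult[OF all_moments_const[of "-1"] Y]] by simp

lemma (in prob_space) all_moments_sum:
  "(\<And>i. i \<in> I \<Longrightarrow> all_moments M (X i)) \<Longrightarrow> all_moments M (\<lambda>\<omega>. \<Sum>i\<in>I. X i \<omega>)"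
  by (induction I rule: infinite_finite_induct) (auto intro: all_moments_const all_moments_add)

lemma (in prob_space) all_moments_power:
  "all_moments M X \<Longrightarrow> all_moments M (\<lambda>\<omega>. X \<omega> ^ k)"
  by (induction k) (auto intro: all_moments_const all_moments_mult)

lemma all_moments_normal:
  assumes "s > 0" and X: "distributed M lborel X (normal_density 0 s)"
  shows "all_moments M X"
  unfolding all_moments_def
proof (intro conjI allI)
  show "X \<in> borel_measurable M"
    using distributed_measurable[OF X] by simp
  fix p
  have "integrable lborel (\<lambda>x. normal_density 0 s x * \<bar>x - 0\<bar> ^ p)"
    by (rule integrable_normal_moment_abs) fact
  then show "integrable M (\<lambda>\<omega>. \<bar>X \<omega>\<bar> ^ p)"
    by (subst distributed_integrable[OF X, symmetric]) auto
qed

lemma normal_even_moment: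
  assumes "s > 0" and X: "distributed M lborel X (normal_density 0 s)"
  shows "(\<integral>\<omega>. X \<omega> ^ (2 * k) \<partial>M) = fact (2 * k) / ((2 / s\<^sup>2) ^ k * fact k)"
  using integral_normal_moment_even[OF assms(1), of 0 k]
  by (subst distributed_integral[OF X, symmetric]) auto

lemma normal_mean:
  assumes "s > 0" and X: "distributed M lborel X (normal_density 0 s)"
  shows "(\<integral>\<omega>. X \<omega> \<partial>M) = 0"
  using integral_normal_moment_nz_1[OF assms(1), of 0]
  by (subst distributed_integral[OF X, symmetric]) auto

lemma normal_second_moment:
  assumes "s > 0" and X: "distributed M lborel X (normal_density 0 s)"
  shows "(\<integral>\<omega>. (X \<omega>)\<^sup>2 \<partial>M) = s\<^sup>2"
  using normal_even_moment[OF assms, of 1] by simp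

lemma normal_fourth_moment:
  assumes "s > 0" and X: "distributed M lborel X (normal_density 0 s)"
  shows "(\<integral>\<omega>. X \<omega> ^ 4 \<partial>M) = 3 * s ^ 4"
  using normal_even_moment[OF assms, of 2] by (simp add: fact_numeral power_divide)

section \<open>Orthogonality, merging of independent blocks, and a Chebyshev bound\<close>

context prob_space
begin

lemma indep_var_of_disjoint:
  assumes "indep_vars (\<lambda>_. borel) W T" "A \<subseteq> T" "B \<subseteq> T" "A \<inter> B = {}"
    and f: "f \<in> measurable (PiM A (\<lambda>_. borel)) F" and g: "g \<in> measurable (PiM B (\<lambda>_. borel)) G"
  shows "indep_var F (\<lambda>\<omega>. f (\<lambda>s\<in>A. W s \<omega>)) G (\<lambda>\<omega>. g (\<lambda>s\<in>B. W s \<omega>))"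
  using indep_var_compose[OF indep_var_restrict[OF assms(1,4,2,3)] f g] by (simp add: comp_def)

text \<open>The summands are orthogonal since the factors \<open>W (t i)\<close> are centred and independent of
  each other and of all coefficients.\<close>

lemma second_moment_indep_combination:
  fixes W :: "'t \<Rightarrow> 'a \<Rightarrow> real" and t :: "'i \<Rightarrow> 't"
  assumes W: "indep_vars (\<lambda>_. borel) W T"
    and "finite I" and t: "inj_on t I" "t ` I \<subseteq> T" and B: "B \<subseteq> T" "t ` I \<inter> B = {}"
    and g: "\<And>i. i \<in> I \<Longrightarrow> g i \<in> borel_measurable (PiM B (\<lambda>_. borel))"
    and mW: "\<And>i. i \<in> I \<Longrightarrow> all_moments M (W (t i))"
    and mg: "\<And>i. i \<in> I \<Longrightarrow> all_moments M (\<lambda>\<omega>. g i (\<lambda>s\<in>B. W s \<omega>))"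
    and mean: "\<And>i. i \<in> I \<Longrightarrow> expectation (W (t i)) = 0"
  shows "expectation (\<lambda>\<omega>. (\<Sum>i\<in>I. W (t i) \<omega> * g i (\<lambda>s\<in>B. W s \<omega>))\<^sup>2) =
    (\<Sum>i\<in>I. expectation (\<lambda>\<omega>. (W (t i) \<omega>)\<^sup>2) * expectation (\<lambda>\<omega>. (g i (\<lambda>s\<in>B. W s \<omega>))\<^sup>2))"
proof -
  define c where "c i \<omega> = g i (\<lambda>s\<in>B. W s \<omega>)" for i \<omega>
  have mc: "all_moments M (c i)" if "i \<in> I" for i
    using mg[OF that] by (simp add: c_def[abs_def])
  \<comment> \<open>The indices \<open>t i\<close> and \<open>t k\<close> lie outside
    \<open>B\<close>, from which all coefficients are read, so the expectation factors. The
    coefficients may depend on one another.\<close>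
  have cross: "expectation (\<lambda>\<omega>. (W (t i) \<omega> * W (t k) \<omega>) * (c i \<omega> * c k \<omega>)) =
      expectation (\<lambda>\<omega>. W (t i) \<omega> * W (t k) \<omega>) * expectation (\<lambda>\<omega>. c i \<omega> * c k \<omega>)"
    if ik: "i \<in> I" "k \<in> I" for i k
  proof (rule indep_var_lebesgue_integral)
    have [measurable]: "g i \<in> borel_measurable (PiM B (\<lambda>_. borel))" "g k \<in> borel_measurable (PiM B (\<lambda>_. borel))"
      using g ik by auto
    have "indep_var borel (\<lambda>\<omega>. (\<lambda>w. w (t i) * w (t k)) (\<lambda>s\<in>t ` I. W s \<omega>))
        borel (\<lambda>\<omega>. (\<lambda>w. g i w * g k w) (\<lambda>s\<in>B. W s \<omega>))"
    proof (rule indep_var_of_disjoint[OF W t(2) B])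
      have [measurable]: "(\<lambda>w. w (t i)) \<in> borel_measurable (PiM (t ` I) (\<lambda>_. borel))"
        "(\<lambda>w. w (t k)) \<in> borel_measurable (PiM (t ` I) (\<lambda>_. borel))"
        using ik by (auto intro!: measurable_component_singleton)
      show "(\<lambda>w. w (t i) * w (t k)) \<in> borel_measurable (PiM (t ` I) (\<lambda>_. borel :: real measure))"
        by measurable
      show "(\<lambda>w. g i w * g k w) \<in> borel_measurable (PiM B (\<lambda>_. borel))"
        by measurable
    qed
    then show "indep_var borel (\<lambda>\<omega>. W (t i) \<omega> * W (t k) \<omega>) borel (\<lambda>\<omega>. c i \<omega> * c k \<omega>)"
      using ik by (simp add: c_def)
  qed (auto intro!: all_moments_integrable all_moments_mult mW mc ik)
  have orth: "expectation (\<lambda>\<omega>. W (t i) \<omega> * W (t k) \<omega>) = 0" if ik: "i \<in> I" "k \<in> I" "i \<noteq> k" for i k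
  proof -
    have "t i \<noteq> t k"
      using t ik by (auto dest: inj_onD)
    then have "indep_var borel (\<lambda>\<omega>. (\<lambda>w. w (t i)) (\<lambda>s\<in>{t i}. W s \<omega>)) borel (\<lambda>\<omega>. (\<lambda>w. w (t k)) (\<lambda>s\<in>{t k}. W s \<omega>))"
      using t ik by (intro indep_var_of_disjoint[OF W] measurable_component_singleton) auto
    then have "expectation (\<lambda>\<omega>. W (t i) \<omega> * W (t k) \<omega>) = expectation (W (t i)) * expectation (W (t k))"
      by (intro indep_var_lebesgue_integral) (auto intro!: all_moments_integrable mW ik)
    then show ?thesis
      using mean ik by simp
  qed
  have "expectation (\<lambda>\<omega>. (\<Sum>i\<in>I. W (t i) \<omega> * c i \<omega>)\<^sup>2) =
      expectation (\<lambda>\<omega>. \<Sum>i\<in>I. \<Sum>k\<in>I. (W (t i) \<omega> * W (t k) \<omega>) * (c i \<omega> * c k \<omega>))"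
    by (simp add: power2_eq_square sum_product mult_ac)
  also have "\<dots> = (\<Sum>i\<in>I. \<Sum>k\<in>I. expectation (\<lambda>\<omega>. (W (t i) \<omega> * W (t k) \<omega>) * (c i \<omega> * c k \<omega>)))"
    by (subst Bochner_Integration.integral_sum)
      (auto intro!: sum.cong all_moments_integrable all_moments_mult all_moments_sum mW mc
        Bochner_Integration.integral_sum)
  also have "\<dots> = (\<Sum>i\<in>I. \<Sum>k\<in>I. if k = i then expectation (\<lambda>\<omega>. (W (t i) \<omega>)\<^sup>2) * expectation (\<lambda>\<omega>. (c i \<omega>)\<^sup>2) else 0)"
    using orth by (intro sum.cong refl) (auto simp: cross power2_eq_square)
  also have "\<dots> = (\<Sum>i\<in>I. expectation (\<lambda>\<omega>. (W (t i) \<omega>)\<^sup>2) * expectation (\<lambda>\<omega>. (c i \<omega>)\<^sup>2))"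
    using \<open>finite I\<close> by simp
  finally show ?thesis
    by (simp add: c_def)
qed

text \<open>An event prescribing finitely many scalars splits into one cylinder per block. Outer
  independence factors over the blocks, and inner independence factors each cylinder. This turns the
  two layers of independence in the model into one family of scalars.\<close>

lemma indep_vars_nested:
  fixes W :: "'i \<times> 'k \<Rightarrow> 'a \<Rightarrow> 'b"
  assumes outer: "indep_vars (\<lambda>i. PiM (T i) N) (\<lambda>i \<omega>. \<lambda>k\<in>T i. W (i, k) \<omega>) I"
    and inner: "\<And>i. i \<in> I \<Longrightarrow> indep_vars N (\<lambda>k. W (i, k)) (T i)"
    and fin: "\<And>i. i \<in> I \<Longrightarrow> finite (T i)"
  shows "indep_vars (\<lambda>(i, k). N k) W (Sigma I T)"
  unfolding indep_vars_def2
proof (intro conjI ballI)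
  show rv: "random_variable (case p of (i, k) \<Rightarrow> N k) (W p)" if "p \<in> Sigma I T" for p
    using that inner by (auto simp: indep_vars_def2)
  show "indep_sets (\<lambda>p. {W p -` A \<inter> space M |A. A \<in> sets (case p of (i, k) \<Rightarrow> N k)}) (Sigma I T)"
  proof (rule indep_setsI)
    fix p assume "p \<in> Sigma I T"
    then show "{W p -` A \<inter> space M |A. A \<in> sets (case p of (i, k) \<Rightarrow> N k)} \<subseteq> events"
      using rv[of p] by (auto intro: measurable_sets)
  next
    fix E L assume L: "L \<noteq> {}" "L \<subseteq> Sigma I T" "finite L"
      and E: "\<forall>p\<in>L. E p \<in> {W p -` A \<inter> space M |A. A \<in> sets (case p of (i, k) \<Rightarrow> N k)}"
    then have "\<forall>p\<in>L. \<exists>A. A \<in> sets (case p of (i, k) \<Rightarrow> N k) \<and> E p = W p -` A \<inter> space M"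
      by blast
    then obtain A where A: "\<And>p. p \<in> L \<Longrightarrow> A p \<in> sets (case p of (i, k) \<Rightarrow> N k)"
        "\<And>p. p \<in> L \<Longrightarrow> E p = W p -` A p \<inter> space M"
      by metis
    define I' where "I' = fst ` L"
    define K where "K i = {k. (i, k) \<in> L}" for i
    have L_eq: "L = Sigma I' K"
      by (force simp: I'_def K_def)
    have I': "I' \<noteq> {}" "finite I'" "I' \<subseteq> I"
      using L by (auto simp: I'_def)
    have K: "K i \<noteq> {}" "finite (K i)" "K i \<subseteq> T i" if "i \<in> I'" for i
    proof -
      show "K i \<noteq> {}"
        using that by (force simp: I'_def K_def)
      show "K i \<subseteq> T i"
        using L by (auto simp: K_def)
      then show "finite (K i)"
        using fin[of i] that I' by (auto intro: finite_subset)
    qed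
    define C where "C i = {w \<in> space (PiM (T i) N). \<forall>k\<in>K i. w k \<in> A (i, k)}" for i
    have C: "C i \<in> sets (PiM (T i) N)" if "i \<in> I'" for i
    proof -
      have "(\<lambda>w. w k) -` A (i, k) \<inter> space (PiM (T i) N) \<in> sets (PiM (T i) N)" if "k \<in> K i" for k
      proof (rule measurable_sets)
        show "(\<lambda>w. w k) \<in> measurable (PiM (T i) N) (N k)"
          using that K[OF \<open>i \<in> I'\<close>] by (intro measurable_component_singleton) auto
        show "A (i, k) \<in> sets (N k)"
          using A(1)[of "(i, k)"] that by (simp add: K_def)
      qed
      then have "(\<Inter>k\<in>K i. (\<lambda>w. w k) -` A (i, k) \<inter> space (PiM (T i) N)) \<in> sets (PiM (T i) N)"
        using K[OF that] by (intro sets.finite_INT) auto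
      also have "(\<Inter>k\<in>K i. (\<lambda>w. w k) -` A (i, k) \<inter> space (PiM (T i) N)) = C i"
        using K[OF that] by (auto simp: C_def)
      finally show ?thesis .
    qed
    have block: "(\<lambda>\<omega>. \<lambda>k\<in>T i. W (i, k) \<omega>) -` C i \<inter> space M = (\<Inter>k\<in>K i. W (i, k) -` A (i, k) \<inter> space M)"
      if i: "i \<in> I'" for i
    proof -
      have "(\<lambda>k\<in>T i. W (i, k) \<omega>) \<in> space (PiM (T i) N)" if "\<omega> \<in> space M" for \<omega>
      proof -
        have "W (i, k) \<omega> \<in> space (N k)" if "k \<in> T i" for k
          using rv[of "(i, k)"] i I' that \<open>\<omega> \<in> space M\<close> by (auto dest: measurable_space)
        then show ?thesis
          by (auto simp: space_PiM)
      qed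
      then show ?thesis
        using K[OF i] by (auto simp: C_def subset_iff)
    qed
    have "prob (\<Inter>p\<in>L. E p) = prob (\<Inter>i\<in>I'. (\<lambda>\<omega>. \<lambda>k\<in>T i. W (i, k) \<omega>) -` C i \<inter> space M)"
    proof (rule arg_cong[where f = prob])
      have "(\<Inter>p\<in>L. E p) = (\<Inter>i\<in>I'. \<Inter>k\<in>K i. E (i, k))"
        by (auto simp: L_eq)
      also have "\<dots> = (\<Inter>i\<in>I'. \<Inter>k\<in>K i. W (i, k) -` A (i, k) \<inter> space M)"
        using A(2) by (intro INF_cong refl) (auto simp: K_def)
      finally show "(\<Inter>p\<in>L. E p) = (\<Inter>i\<in>I'. (\<lambda>\<omega>. \<lambda>k\<in>T i. W (i, k) \<omega>) -` C i \<inter> space M)"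
        using block by simp
    qed
    also have "\<dots> = (\<Prod>i\<in>I'. prob ((\<lambda>\<omega>. \<lambda>k\<in>T i. W (i, k) \<omega>) -` C i \<inter> space M))"
      using I' C by (intro indep_varsD[OF outer]) auto
    also have "\<dots> = (\<Prod>i\<in>I'. \<Prod>k\<in>K i. prob (W (i, k) -` A (i, k) \<inter> space M))"
    proof (rule prod.cong[OF refl])
      fix i assume i: "i \<in> I'"
      have "A (i, k) \<in> sets (N k)" if "k \<in> K i" for k
        using A(1)[of "(i, k)"] that by (simp add: K_def)
      then show "prob ((\<lambda>\<omega>. \<lambda>k\<in>T i. W (i, k) \<omega>) -` C i \<inter> space M) = (\<Prod>k\<in>K i. prob (W (i, k) -` A (i, k) \<inter> space M))"
        unfolding block[OF i] using K[OF i] i I' by (intro indep_varsD[OF inner[of i]]) auto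
    qed
    also have "\<dots> = (\<Prod>i\<in>I'. \<Prod>k\<in>K i. prob (E (i, k)))"
      using A(2) by (intro prod.cong refl) (auto simp: K_def)
    also have "\<dots> = (\<Prod>p\<in>L. prob (E p))"
      unfolding L_eq using I' K by (subst prod.Sigma) auto
    finally show "prob (\<Inter>p\<in>L. E p) = (\<Prod>p\<in>L. prob (E p))" .
  qed
qed

text \<open>Chebyshev's inequality: a nonpositive sum lies at least \<open>card I * \<mu>\<close>
  below its mean, while its variance is at most \<open>card I * C\<close>. The remaining factor
  \<open>1 / card I\<close> gives the convergence in Part 1.\<close>

lemma prob_sum_nonpos_le:
  fixes Z :: "'i \<Rightarrow> 'a \<Rightarrow> real"
  assumes Z: "indep_vars (\<lambda>_. borel) Z I" and I: "finite I" "I \<noteq> {}"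
    and mom: "\<And>i. i \<in> I \<Longrightarrow> all_moments M (Z i)"
    and "\<mu> > 0" and mean: "\<And>i. i \<in> I \<Longrightarrow> \<mu> \<le> expectation (Z i)"
    and sq: "\<And>i. i \<in> I \<Longrightarrow> expectation (\<lambda>\<omega>. (Z i \<omega>)\<^sup>2) \<le> C"
  shows "prob {\<omega> \<in> space M. (\<Sum>i\<in>I. Z i \<omega>) \<le> 0} \<le> C / (real (card I) * \<mu>\<^sup>2)"
proof -
  define Y where "Y i \<omega> = Z i \<omega> - expectation (Z i)" for i \<omega>
  have mY: "all_moments M (Y i)" if "i \<in> I" for i
    unfolding Y_def using mom[OF that] by (intro all_moments_diff all_moments_const)
  have Y: "indep_vars (\<lambda>_. borel) Y I"
    unfolding Y_def by (rule indep_vars_compose2[OF Z]) simp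
  have meanY: "expectation (Y i) = 0" if "i \<in> I" for i
    unfolding Y_def using all_moments_integrable[OF mom[OF that]] by (simp add: prob_space)
  have sqY: "expectation (\<lambda>\<omega>. (Y i \<omega>)\<^sup>2) \<le> C" if "i \<in> I" for i
  proof -
    have "variance (Z i) = expectation (\<lambda>\<omega>. (Z i \<omega>)\<^sup>2) - (expectation (Z i))\<^sup>2"
      using mom[OF that] by (intro variance_eq all_moments_integrable all_moments_power)
    also have "\<dots> \<le> C"
      using sq[OF that] by (smt (verit) zero_le_power2)
    finally show ?thesis
      by (simp add: Y_def)
  qed
  have mS: "all_moments M (\<lambda>\<omega>. \<Sum>i\<in>I. Y i \<omega>)"
    by (intro all_moments_sum mY)
  have card: "real (card I) > 0"
    using I by (simp add: card_gt_0_iff)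
  \<comment> \<open>With \<open>B = {}\<close> and all coefficients equal to 1, the orthogonality
    lemma is the additivity of the variance.\<close>
  have "expectation (\<lambda>\<omega>. (\<Sum>i\<in>I. Y i \<omega>)\<^sup>2) = (\<Sum>i\<in>I. expectation (\<lambda>\<omega>. (Y i \<omega>)\<^sup>2))"
    using second_moment_indep_combination[OF Y, of I "\<lambda>i. i" "{}" "\<lambda>_ _. 1"] I mY meanY
    by (simp add: all_moments_const prob_space)
  also have "\<dots> \<le> real (card I) * C"
    using sum_bounded_above[of I "\<lambda>i. expectation (\<lambda>\<omega>. (Y i \<omega>)\<^sup>2)" C] sqY by simp
  finally have var: "expectation (\<lambda>\<omega>. (\<Sum>i\<in>I. Y i \<omega>)\<^sup>2) \<le> real (card I) * C" .
  have [measurable]: "(\<lambda>\<omega>. \<Sum>i\<in>I. Y i \<omega>) \<in> borel_measurable M"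
    using all_moments_measurable[OF mS] .
  have "prob {\<omega> \<in> space M. (\<Sum>i\<in>I. Z i \<omega>) \<le> 0} \<le>
      prob {\<omega> \<in> space M. \<bar>\<Sum>i\<in>I. Y i \<omega>\<bar> \<ge> real (card I) * \<mu>}"
  proof (rule finite_measure_mono)
    have "(\<Sum>i\<in>I. expectation (Z i)) \<ge> real (card I) * \<mu>"
      using sum_bounded_below[of I \<mu> "\<lambda>i. expectation (Z i)"] mean by simp
    then show "{\<omega> \<in> space M. (\<Sum>i\<in>I. Z i \<omega>) \<le> 0} \<subseteq> {\<omega> \<in> space M. \<bar>\<Sum>i\<in>I. Y i \<omega>\<bar> \<ge> real (card I) * \<mu>}"
      by (auto simp: Y_def sum_subtractf)
  qed measurable
  also have "\<dots> \<le> expectation (\<lambda>\<omega>. (\<Sum>i\<in>I. Y i \<omega>)\<^sup>2) / (real (card I) * \<mu>)\<^sup>2"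
    using card \<open>\<mu> > 0\<close> all_moments_integrable[OF all_moments_power[OF mS, of 2]]
    by (intro second_moment_method) auto
  also have "\<dots> \<le> (real (card I) * C) / (real (card I) * \<mu>)\<^sup>2"
    using var by (intro divide_right_mono) auto
  also have "\<dots> = C / (real (card I) * \<mu>\<^sup>2)"
    using card \<open>\<mu> > 0\<close> by (simp add: power2_eq_square)
  finally show ?thesis .
qed

end

section \<open>Kernels and random determinants\<close>

text \<open>For a sensor with \<open>card S\<close> rows this is the square submatrix that Trivial
  Pursuit inverts. \<open>Suc\<close> reconciles rows counted from 1 with matrix indices counted
  from 0.\<close>

definition column_mat :: "(nat \<Rightarrow> nat \<Rightarrow> real) \<Rightarrow> nat set \<Rightarrow> real mat" where
  "column_mat A S = mat (card S) (card S) (\<lambda>(i, j). A (Suc i) (sorted_list_of_set S ! j))"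

text \<open>The bridge between determinants and vectors indexed by the elements of \<open>S\<close>:
  coordinates are carried along the increasing enumeration \<open>e\<close> of \<open>S\<close>, in
  both directions.\<close>

lemma det_column_mat_eq_0_iff:
  assumes "finite S"
  shows "Determinant.det (column_mat A S) = 0 \<longleftrightarrow>
    (\<exists>v. (\<exists>n\<in>S. v n \<noteq> 0) \<and> (\<forall>m\<in>{1..card S}. (\<Sum>n\<in>S. A m n * v n) = 0))"
proof -
  define k where "k = card S"
  define e where "e j = sorted_list_of_set S ! j" for j
  have e: "bij_betw e {..<k} S"
    using bij_betw_nth[of "sorted_list_of_set S" "{..<k}" S] assms by (simp add: e_def[abs_def] k_def)
  have carrier: "column_mat A S \<in> carrier_mat k k"
    by (simp add: column_mat_def k_def)
  have sum_e: "(\<Sum>n\<in>S. f n) = (\<Sum>j<k. f (e j))" for f :: "nat \<Rightarrow> real"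
    using sum.reindex_bij_betw[OF e, of f] by simp
  have mult: "(column_mat A S *\<^sub>v v) $ i = (\<Sum>j<k. A (Suc i) (e j) * v $ j)"
    if "i < k" "v \<in> carrier_vec k" for v i
    using that by (auto simp: column_mat_def scalar_prod_def k_def e_def lessThan_atLeast0 intro!: sum.cong)
  have rows: "(\<forall>m\<in>{1..card S}. P m) \<longleftrightarrow> (\<forall>i<k. P (Suc i))" for P
    by (auto simp: k_def) (metis One_nat_def Suc_le_D Suc_le_eq)
  show ?thesis
    unfolding det_0_iff_vec_prod_zero[OF carrier] rows
  proof safe
    fix v assume v: "v \<in> carrier_vec k" "v \<noteq> 0\<^sub>v k" "column_mat A S *\<^sub>v v = 0\<^sub>v k"
    define v' where "v' n = v $ (the_inv_into {..<k} e n)" for n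
    have v': "v' (e j) = v $ j" if "j < k" for j
      using that e by (simp add: v'_def the_inv_into_f_f bij_betw_imp_inj_on)
    obtain j where "j < k" "v $ j \<noteq> 0"
      using v(1,2) by (metis carrier_vecD eq_vecI index_zero_vec(1) index_zero_vec(2))
    then have "\<exists>n\<in>S. v' n \<noteq> 0"
      using v' e by (metis bij_betwE lessThan_iff)
    moreover have "(\<Sum>n\<in>S. A (Suc i) n * v' n) = 0" if "i < k" for i
      using mult[OF that v(1)] v(3) that by (simp add: sum_e v')
    ultimately show "\<exists>v. (\<exists>n\<in>S. v n \<noteq> 0) \<and> (\<forall>i<k. (\<Sum>n\<in>S. A (Suc i) n * v n) = 0)"
      by blast
  next
    fix v n assume v: "n \<in> S" "v n \<noteq> 0" "\<forall>i<k. (\<Sum>n\<in>S. A (Suc i) n * v n) = 0"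
    obtain j where j: "j < k" "n = e j"
      using v(1) e by (metis bij_betw_imp_surj_on imageE lessThan_iff)
    define u where "u = vec k (\<lambda>j. v (e j))"
    have "u \<in> carrier_vec k"
      by (simp add: u_def)
    moreover have "u \<noteq> 0\<^sub>v k"
      using v(2) j by (auto simp: u_def vec_eq_iff)
    moreover have "column_mat A S *\<^sub>v u = 0\<^sub>v k"
    proof (rule eq_vecI)
      fix i assume "i < dim_vec (0\<^sub>v k)"
      then show "(column_mat A S *\<^sub>v u) $ i = 0\<^sub>v k $ i"
        using v(3) mult[of i u] \<open>u \<in> carrier_vec k\<close> by (simp add: sum_e u_def)
    qed (simp add: column_mat_def k_def)
    ultimately show "\<exists>v. v \<in> carrier_vec k \<and> v \<noteq> 0\<^sub>v k \<and> column_mat A S *\<^sub>v v = 0\<^sub>v k"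
      by blast
  qed
qed

lemma underdetermined_kernel:
  fixes A :: "nat \<Rightarrow> nat \<Rightarrow> real"
  assumes "finite S" "r < card S"
  shows "\<exists>v. (\<exists>n\<in>S. v n \<noteq> 0) \<and> (\<forall>m\<in>{1..r}. (\<Sum>n\<in>S. A m n * v n) = 0)"
proof -
  \<comment> \<open>Zero rows pad the system to a square one. Row \<open>card S\<close> is among
    them because \<open>r < card S\<close>, so expanding along it gives determinant 0.\<close>
  define B where "B m n = (if m \<le> r then A m n else 0)" for m n :: nat
  have "Determinant.det (column_mat B S) =
      (\<Sum>j<card S. column_mat B S $$ (card S - 1, j) * cofactor (column_mat B S) (card S - 1) j)"
    using assms by (intro laplace_expansion_row) (auto simp: column_mat_def)
  also have "\<dots> = 0"
  proof (intro sum.neutral ballI)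
    fix j assume "j \<in> {..<card S}"
    then have "column_mat B S $$ (card S - 1, j) = 0"
      using assms by (simp add: column_mat_def B_def)
    then show "column_mat B S $$ (card S - 1, j) * cofactor (column_mat B S) (card S - 1) j = 0"
      by simp
  qed
  finally have "Determinant.det (column_mat B S) = 0" .
  then obtain v where v: "\<exists>n\<in>S. v n \<noteq> 0" "\<forall>m\<in>{1..card S}. (\<Sum>n\<in>S. B m n * v n) = 0"
    using det_column_mat_eq_0_iff[OF assms(1)] by auto
  have "(\<Sum>n\<in>S. A m n * v n) = 0" if "m \<in> {1..r}" for m
    using bspec[OF v(2), of m] that assms by (simp add: B_def)
  with v(1) show ?thesis
    by (intro exI[of _ v]) auto
qed

section \<open>Random determinants: measurability and almost sure non-vanishing\<close>

lemma borel_measurable_det: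
  fixes f :: "'a \<Rightarrow> nat \<Rightarrow> nat \<Rightarrow> real"
  assumes "\<And>i j. i < n \<Longrightarrow> j < n \<Longrightarrow> (\<lambda>w. f w i j) \<in> borel_measurable N"
  shows "(\<lambda>w. Determinant.det (mat n n (\<lambda>(i, j). f w i j))) \<in> borel_measurable N"
proof -
  \<comment> \<open>The Leibniz formula exhibits the determinant as a polynomial in the
    entries.\<close>
  have "Determinant.det (mat n n (\<lambda>(i, j). f w i j)) =
      (\<Sum>p\<in>{p. p permutes {0..<n}}. signof p * (\<Prod>i = 0..<n. f w i (p i)))" for w
    by (subst det_def'[of _ n]) (auto intro!: sum.cong prod.cong simp: permutes_in_image)
  moreover have "(\<lambda>w. \<Sum>p\<in>{p. p permutes {0..<n}}. signof p * (\<Prod>i = 0..<n. f w i (p i))) \<in> borel_measurable N"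
    by (intro borel_measurable_sum borel_measurable_times borel_measurable_const borel_measurable_prod assms)
      (auto simp: permutes_in_image)
  ultimately show ?thesis
    by simp
qed

lemma det_mat_cong:
  assumes "\<And>i j. i < n \<Longrightarrow> j < n \<Longrightarrow> f i j = g i j"
  shows "Determinant.det (mat n n (\<lambda>(i, j). f i j)) = Determinant.det (mat n n (\<lambda>(i, j). g i j))"
  by (rule arg_cong[of _ _ Determinant.det], rule eq_matI) (simp_all add: assms)

lemma mat_delete_mat:
  "mat_delete (mat (Suc k) (Suc k) f) i j =
    mat k k (\<lambda>(a, b). f (if a < i then a else Suc a, if b < j then b else Suc b))"
  by (auto simp: mat_delete_def)

context prob_space
begin

text \<open>Fubini: by independence the joint law is a product, and for each fixed value of
  \<open>Y\<close> the event that \<open>X\<close> hits that value is null.\<close>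

lemma AE_neq_indep_atomless:
  fixes X Y :: "'a \<Rightarrow> real"
  assumes XY: "indep_var borel Y borel X" and X: "\<And>c. AE \<omega> in M. X \<omega> \<noteq> c"
  shows "AE \<omega> in M. X \<omega> \<noteq> Y \<omega>"
proof -
  have [measurable]: "X \<in> borel_measurable M" "Y \<in> borel_measurable M"
    using indep_var_rv1[OF XY] indep_var_rv2[OF XY] by auto
  interpret X: prob_space "distr M borel X" by (rule prob_space_distr) simp
  interpret Y: prob_space "distr M borel Y" by (rule prob_space_distr) simp
  interpret YX: pair_sigma_finite "distr M borel Y" "distr M borel X" ..
  have "AE p in distr M borel Y \<Otimes>\<^sub>M distr M borel X. snd p \<noteq> fst p"
  proof (rule YX.AE_pair_measure)
    have "{p \<in> space (borel \<Otimes>\<^sub>M borel). snd p \<noteq> fst p} \<in> sets (borel \<Otimes>\<^sub>M (borel :: real measure))"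
      by measurable
    then show "{p \<in> space (distr M borel Y \<Otimes>\<^sub>M distr M borel X). snd p \<noteq> fst p}
        \<in> sets (distr M borel Y \<Otimes>\<^sub>M distr M borel X)"
      using sets_pair_measure_cong[of "distr M borel Y" borel "distr M borel X" borel]
      by (simp add: space_pair_measure)
  qed (auto simp: AE_distr_iff X)
  then have "AE p in distr M (borel \<Otimes>\<^sub>M borel) (\<lambda>\<omega>. (Y \<omega>, X \<omega>)). snd p \<noteq> fst p"
    using XY unfolding indep_var_distribution_eq by metis
  then show ?thesis
    by (subst (asm) AE_distr_iff) auto
qed

text \<open>Expanding along the last row, the corner entry enters linearly with the previous leading
  principal minor as its coefficient, and it is independent of everything else.\<close>

lemma AE_det_neq_0:
  fixes W :: "nat \<times> nat \<Rightarrow> 'a \<Rightarrow> real"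
  assumes W: "indep_vars (\<lambda>_. borel) W T"
    and atomless: "\<And>t c. t \<in> T \<Longrightarrow> AE \<omega> in M. W t \<omega> \<noteq> c"
    and r: "inj_on r {..<n}" and c: "inj_on c {..<n}"
    and T: "\<And>i j. i < n \<Longrightarrow> j < n \<Longrightarrow> (r i, c j) \<in> T"
  shows "AE \<omega> in M. Determinant.det (mat n n (\<lambda>(i, j). W (r i, c j) \<omega>)) \<noteq> 0"
  using r c T
proof (induction n)
  case 0
  then show ?case
    by (simp add: det_def')
next
  case (Suc k)
  have IH: "AE \<omega> in M. Determinant.det (mat k k (\<lambda>(i, j). W (r i, c j) \<omega>)) \<noteq> 0"
    using Suc.prems by (intro Suc.IH) (auto simp: inj_on_def)
  define F where "F w = mat (Suc k) (Suc k) (\<lambda>(i, j). w (r i, c j))" for w :: "nat \<times> nat \<Rightarrow> real"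
  define D where "D w = Determinant.det (mat k k (\<lambda>(i, j). w (r i, c j)))" for w :: "nat \<times> nat \<Rightarrow> real"
  define R where "R w = (\<Sum>j<k. w (r k, c j) * cofactor (F w) k j)" for w :: "nat \<times> nat \<Rightarrow> real"
  have expand: "Determinant.det (F w) = w (r k, c k) * D w + R w" for w
  proof -
    have "Determinant.det (F w) = (\<Sum>j<Suc k. F w $$ (k, j) * cofactor (F w) k j)"
      by (rule laplace_expansion_row) (auto simp: F_def)
    also have "\<dots> = F w $$ (k, k) * cofactor (F w) k k + (\<Sum>j<k. F w $$ (k, j) * cofactor (F w) k j)"
      by simp
    also have "cofactor (F w) k k = D w"
      by (auto simp: cofactor_def F_def D_def mat_delete_mat intro!: arg_cong[of _ _ Determinant.det])
    also have "(\<Sum>j<k. F w $$ (k, j) * cofactor (F w) k j) = R w"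
      by (simp add: R_def F_def)
    finally show ?thesis
      by (simp add: F_def)
  qed
  \<comment> \<open>All positions except the corner; injectivity of \<open>r\<close> and
    \<open>c\<close> keeps the corner's own index out.\<close>
  define B where "B = (\<lambda>(i, j). (r i, c j)) ` ({..k} \<times> {..k} - {(k, k)})"
  have inB: "(r i, c j) \<in> B" if "i \<le> k" "j \<le> k" "(i, j) \<noteq> (k, k)" for i j
    using that by (force simp: B_def)
  have inB': "(r i, c (if b < j then b else Suc b)) \<in> B" if "i < k" "b < k" for i b j
    using that by (cases "b < j") (simp_all add: inB)
  have notB: "(r k, c k) \<notin> B"
    using Suc.prems(1,2) by (auto simp: B_def inj_on_def)
  have comp: "(\<lambda>w. w (r i, c j)) \<in> borel_measurable (PiM B (\<lambda>_. borel :: real measure))"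
    if "i \<le> k" "j \<le> k" "(i, j) \<noteq> (k, k)" for i j
    using inB[OF that] by (rule measurable_component_singleton)
  \<comment> \<open>Deleting row \<open>k\<close> removes the corner, so these cofactors read only
    entries indexed by \<open>B\<close>.\<close>
  have cof: "cofactor (F w) k j = (- 1) ^ (k + j) *
      Determinant.det (mat k k (\<lambda>(a, b). w (r a, c (if b < j then b else Suc b))))" for w j
    by (auto simp: cofactor_def F_def mat_delete_mat intro!: arg_cong[of _ _ Determinant.det])
  have D [measurable]: "D \<in> borel_measurable (PiM B (\<lambda>_. borel))"
    unfolding D_def by (intro borel_measurable_det comp) auto
  have R [measurable]: "R \<in> borel_measurable (PiM B (\<lambda>_. borel))"
    unfolding R_def cof
    by (intro borel_measurable_sum borel_measurable_times borel_measurable_const borel_measurable_det comp) auto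
  have D_cong: "D (\<lambda>s\<in>B. W s \<omega>) = D (\<lambda>s. W s \<omega>)" for \<omega>
    unfolding D_def by (rule det_mat_cong) (simp add: inB)
  have cof_cong: "cofactor (F (\<lambda>s\<in>B. W s \<omega>)) k j = cofactor (F (\<lambda>s. W s \<omega>)) k j" for \<omega> j
  proof -
    have "(\<lambda>s\<in>B. W s \<omega>) (r a, c (if b < j then b else Suc b)) = W (r a, c (if b < j then b else Suc b)) \<omega>"
      if "a < k" "b < k" for a b
      by (rule restrict_apply') (rule inB'[OF that])
    then have "Determinant.det (mat k k (\<lambda>(a, b). (\<lambda>s\<in>B. W s \<omega>) (r a, c (if b < j then b else Suc b)))) =
        Determinant.det (mat k k (\<lambda>(a, b). W (r a, c (if b < j then b else Suc b)) \<omega>))"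
      by (rule det_mat_cong)
    then show ?thesis
      unfolding cof by (rule arg_cong)
  qed
  have R_cong: "R (\<lambda>s\<in>B. W s \<omega>) = R (\<lambda>s. W s \<omega>)" for \<omega>
    unfolding R_def cof_cong
  proof (rule sum.cong[OF refl])
    fix j assume j: "j \<in> {..<k}"
    have "(\<lambda>s\<in>B. W s \<omega>) (r k, c j) = W (r k, c j) \<omega>"
      using j by (intro restrict_apply' inB) auto
    then show "(\<lambda>s\<in>B. W s \<omega>) (r k, c j) * cofactor (F (\<lambda>s. W s \<omega>)) k j =
        W (r k, c j) \<omega> * cofactor (F (\<lambda>s. W s \<omega>)) k j"
      by (rule arg_cong)
  qed
  \<comment> \<open>\<open>- R / D\<close> is the only value of the corner at which the determinant
    vanishes. Where \<open>D\<close> is 0 the quotient is 0 by convention and still measurable; the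
    induction hypothesis makes that case null.\<close>
  have "indep_var borel (\<lambda>\<omega>. (\<lambda>w. - R w / D w) (\<lambda>s\<in>B. W s \<omega>))
      borel (\<lambda>\<omega>. (\<lambda>w. w (r k, c k)) (\<lambda>s\<in>{(r k, c k)}. W s \<omega>))"
  proof (rule indep_var_of_disjoint[OF W])
    show "B \<subseteq> T"
      using Suc.prems(3) by (auto simp: B_def)
    show "(\<lambda>w. - R w / D w) \<in> borel_measurable (PiM B (\<lambda>_. borel))"
      by measurable
  qed (use notB Suc.prems(3) in \<open>auto intro!: measurable_component_singleton\<close>)
  then have "AE \<omega> in M. W (r k, c k) \<omega> \<noteq> - R (\<lambda>s. W s \<omega>) / D (\<lambda>s. W s \<omega>)"
    using Suc.prems(3) by (intro AE_neq_indep_atomless[OF _ atomless]) (simp_all add: D_cong R_cong)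
  with IH have "AE \<omega> in M. Determinant.det (F (\<lambda>s. W s \<omega>)) \<noteq> 0"
  proof eventually_elim
    case (elim \<omega>)
    then have "D (\<lambda>s. W s \<omega>) \<noteq> 0"
      by (simp add: D_def)
    with elim(2) show ?case
      by (auto simp: expand field_simps)
  qed
  then show ?case
    by (simp add: F_def)
qed

lemma AE_normal_neq:
  assumes X: "distributed M lborel X (normal_density 0 s)"
  shows "AE \<omega> in M. X \<omega> \<noteq> c"
proof -
  have [measurable]: "X \<in> borel_measurable M"
    using distributed_measurable[OF X] by simp
  have "AE x in distr M lborel X. x \<noteq> c"
    unfolding distributed_distr_eq_density[OF X]
    by (subst AE_density) (auto intro: AE_mp[OF AE_lborel_singleton])
  then show ?thesis
    by (subst (asm) AE_distr_iff) auto
qed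

end

section \<open>Solvability and recovery\<close>

lemma measure_vec_eq_sum:
  assumes "S \<subseteq> {1..N}" "\<And>n. n \<notin> S \<Longrightarrow> x n = 0"
  shows "measure_vec N A x m = (\<Sum>n\<in>S. A m n * x n)"
  unfolding measure_vec_def using assms by (intro sum.mono_neutral_right) auto

text \<open>Solutions of the restricted system differ by kernel vectors, so uniqueness amounts to a
  nonzero determinant. The converse direction matters too: it turns an equality of sets of functions
  into conditions on random variables, which makes the recovery event measurable.\<close>

lemma tp_estimates_eq_singleton_iff:
  assumes S: "S \<subseteq> {1..N}"
  shows "tp_estimates (card S) A (measure_vec N A x) S = {x} \<longleftrightarrow>
    (\<forall>n. n \<notin> S \<longrightarrow> x n = 0) \<and> Determinant.det (column_mat A S) \<noteq> 0"
proof -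
  have "finite S"
    using S by (rule finite_subset) simp
  note det = det_column_mat_eq_0_iff[OF this, of A]
  show ?thesis
  proof safe
    fix n assume eq: "tp_estimates (card S) A (measure_vec N A x) S = {x}" and "n \<notin> S"
    then have "x \<in> tp_estimates (card S) A (measure_vec N A x) S"
      by simp
    then obtain v where "x = (\<lambda>n. if n \<in> S then v n else 0)"
      unfolding tp_estimates_def by blast
    then show "x n = 0"
      using \<open>n \<notin> S\<close> by simp
  next
    assume eq: "tp_estimates (card S) A (measure_vec N A x) S = {x}"
      and "Determinant.det (column_mat A S) = 0"
    then obtain h n where h: "n \<in> S" "h n \<noteq> 0" "\<forall>m\<in>{1..card S}. (\<Sum>n\<in>S. A m n * h n) = 0"
      using det by auto
    have "x \<in> tp_estimates (card S) A (measure_vec N A x) S"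
      using eq by simp
    then obtain v where v: "x = (\<lambda>n. if n \<in> S then v n else 0)"
        "\<forall>m\<in>{1..card S}. measure_vec N A x m = (\<Sum>n\<in>S. A m n * v n)"
      unfolding tp_estimates_def by blast
    have "(\<lambda>n. if n \<in> S then v n + h n else 0) \<in> tp_estimates (card S) A (measure_vec N A x) S"
      unfolding tp_estimates_def using v(2) h(3)
      by (auto simp: distrib_left sum.distrib intro!: exI[of _ "\<lambda>n. v n + h n"])
    then have "(\<lambda>n. if n \<in> S then v n + h n else 0) = x"
      using eq by auto
    then show False
      using v(1) h(1,2) by (auto dest!: fun_cong[of _ _ n])
  next
    fix z assume x: "\<forall>n. n \<notin> S \<longrightarrow> x n = 0" and nz: "Determinant.det (column_mat A S) \<noteq> 0"
      and z: "z \<in> tp_estimates (card S) A (measure_vec N A x) S"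
    obtain v where v: "z = (\<lambda>n. if n \<in> S then v n else 0)"
        "\<forall>m\<in>{1..card S}. measure_vec N A x m = (\<Sum>n\<in>S. A m n * v n)"
      using z unfolding tp_estimates_def by blast
    have "\<forall>m\<in>{1..card S}. (\<Sum>n\<in>S. A m n * (v n - x n)) = 0"
      using v(2) x S by (auto simp: right_diff_distrib sum_subtractf measure_vec_eq_sum[of S])
    then have "\<forall>n\<in>S. v n - x n = 0"
      using det[THEN iffD2, OF exI[of _ "\<lambda>n. v n - x n"]] nz by auto
    then show "z = x"
      using v(1) x by auto
  next
    assume x: "\<forall>n. n \<notin> S \<longrightarrow> x n = 0"
    then have "x = (\<lambda>n. if n \<in> S then x n else 0)"
      by auto
    moreover have "\<forall>m\<in>{1..card S}. measure_vec N A x m = (\<Sum>n\<in>S. A m n * x n)"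
      using x S by (simp add: measure_vec_eq_sum[of S])
    ultimately show "x \<in> tp_estimates (card S) A (measure_vec N A x) S"
      unfolding tp_estimates_def by blast
  qed
qed

text \<open>A different set of the same size contains some \<open>k\<close> outside \<Omega> and
  misses some \<open>n\<close> in \<Omega>; the selection rule orders this pair one way and the gap
  strictly the other way. The strict gap thus leaves no ties that matter.\<close>

lemma tp_support_unique:
  assumes \<Omega>: "finite \<Omega>" "card \<Omega> = K" "\<Omega> \<subseteq> {1..N}"
    and gap: "\<And>n k. n \<in> \<Omega> \<Longrightarrow> k \<in> {1..N} - \<Omega> \<Longrightarrow> \<xi> k < \<xi> n"
    and S: "tp_support N K \<xi> S"
  shows "S = \<Omega>"
proof (rule ccontr)
  assume "S \<noteq> \<Omega>"
  have "finite S" "card S = card \<Omega>"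
    using S \<Omega> by (auto simp: tp_support_def intro: finite_subset)
  then have "\<not> S \<subseteq> \<Omega>" "\<not> \<Omega> \<subseteq> S"
    using \<open>S \<noteq> \<Omega>\<close> \<Omega> by (auto dest: card_subset_eq)
  then obtain k n where "k \<in> S - \<Omega>" "n \<in> \<Omega> - S"
    by blast
  then have "\<xi> n \<le> \<xi> k" "\<xi> k < \<xi> n"
    using S \<Omega> gap[of n k] by (auto simp: tp_support_def)
  then show False by simp
qed

section \<open>Non-uniqueness when a sensor has too few rows\<close>

lemma perturb_nonzero:
  fixes x h :: "'i \<Rightarrow> real"
  assumes "finite S" "\<And>n. n \<in> S \<Longrightarrow> x n \<noteq> 0"
  shows "\<exists>t. t \<noteq> 0 \<and> (\<forall>n\<in>S. x n + t * h n \<noteq> 0)"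
proof -
  \<comment> \<open>Each index with \<open>h n \<noteq> 0\<close> excludes one value of
    \<open>t\<close>. Where \<open>h n = 0\<close> the quotient is 0 by convention, a value that is
    excluded anyway.\<close>
  have "finite (insert 0 ((\<lambda>n. - x n / h n) ` S))"
    using assms(1) by simp
  then obtain t where t: "t \<notin> insert 0 ((\<lambda>n. - x n / h n) ` S)"
    using ex_new_if_finite[OF infinite_UNIV_char_0] by blast
  have "x n + t * h n \<noteq> 0" if n: "n \<in> S" for n
  proof (cases "h n = 0")
    case False
    have "t \<noteq> - x n / h n"
      using t n by auto
    then show ?thesis
      using False by (auto simp: field_simps eq_neg_iff_add_eq_0)
  qed (use assms(2) n in auto)
  then show ?thesis
    using t by auto
qed

lemma another_ensemble:
  fixes \<Phi> :: "nat \<Rightarrow> nat \<Rightarrow> nat \<Rightarrow> real" and x :: "nat \<Rightarrow> nat \<Rightarrow> real"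
  assumes \<Omega>: "\<Omega> \<subseteq> {1..N}" and j: "j \<in> {1..J}" "M j < card \<Omega>"
    and nz: "\<And>i n. i \<in> {1..J} \<Longrightarrow> n \<in> \<Omega> \<Longrightarrow> x i n \<noteq> 0"
    and z: "\<And>i n. i \<in> {1..J} \<Longrightarrow> n \<notin> \<Omega> \<Longrightarrow> x i n = 0"
  shows "\<exists>x'. (\<forall>i\<in>{1..J}. {n. x' i n \<noteq> 0} = \<Omega>) \<and> x' j \<noteq> x j \<and>
    (\<forall>i\<in>{1..J}. \<forall>m\<in>{1..M i}. measure_vec N (\<Phi> i) (x' i) m = measure_vec N (\<Phi> i) (x i) m)"
proof -
  have fin: "finite \<Omega>"
    using \<Omega> by (rule finite_subset) simp
  obtain h n where h: "n \<in> \<Omega>" "h n \<noteq> 0" "\<forall>m\<in>{1..M j}. (\<Sum>n\<in>\<Omega>. \<Phi> j m n * h n) = 0"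
    using underdetermined_kernel[OF fin j(2), of "\<Phi> j"] by blast
  obtain t where t: "t \<noteq> 0" "\<forall>n\<in>\<Omega>. x j n + t * h n \<noteq> 0"
    using perturb_nonzero[OF fin, of "x j" h] nz j by auto
  define u where "u n = (if n \<in> \<Omega> then x j n + t * h n else 0)" for n
  have "u n \<noteq> x j n"
    using h t by (simp add: u_def)
  moreover have "measure_vec N (\<Phi> j) u m = measure_vec N (\<Phi> j) (x j) m" if m: "m \<in> {1..M j}" for m
  proof -
    have "measure_vec N (\<Phi> j) u m = (\<Sum>n\<in>\<Omega>. \<Phi> j m n * u n)"
      using \<Omega> by (intro measure_vec_eq_sum) (auto simp: u_def)
    also have "\<dots> = (\<Sum>n\<in>\<Omega>. \<Phi> j m n * x j n) + t * (\<Sum>n\<in>\<Omega>. \<Phi> j m n * h n)"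
      unfolding u_def sum_distrib_left by (simp add: sum.distrib[symmetric] algebra_simps)
    also have "\<dots> = (\<Sum>n\<in>\<Omega>. \<Phi> j m n * x j n)"
      using h(3) m by simp
    also have "\<dots> = measure_vec N (\<Phi> j) (x j) m"
      using \<Omega> z j by (intro measure_vec_eq_sum[symmetric]) auto
    finally show ?thesis .
  qed
  moreover have "{n. u n \<noteq> 0} = \<Omega>"
    using t by (auto simp: u_def)
  \<comment> \<open>The witness is \<open>x(j := u)\<close>. The other signals stay as they are, so
    each must itself have exactly the support \<Omega>.\<close>
  moreover have "{n. x i n \<noteq> 0} = \<Omega>" if "i \<in> {1..J}" for i
    using nz[OF that] z[OF that] by auto
  ultimately show ?thesis
    by (intro exI[of _ "x(j := u)"]) auto
qed

lemma (in prob_space) AE_another_ensemble: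
  assumes \<Omega>: "\<Omega> \<subseteq> {1..N}" and ens: "jsm2_ensemble M J N \<Omega> \<sigma> m x \<Phi>"
    and j: "j \<in> {1..J}" "m j < card \<Omega>"
  shows "AE \<omega> in M. \<exists>x' \<Omega>'. \<Omega>' \<subseteq> {1..N} \<and> card \<Omega>' = card \<Omega> \<and>
    (\<forall>i\<in>{1..J}. {n. x' i n \<noteq> 0} = \<Omega>') \<and> x' j \<noteq> x j \<omega> \<and>
    (\<forall>i\<in>{1..J}. \<forall>k\<in>{1..m i}.
      measure_vec N (\<Phi> i \<omega>) (x' i) k = measure_vec N (\<Phi> i \<omega>) (x i \<omega>) k)"
proof -
  have "finite ({1..J} \<times> \<Omega>)"
    using \<Omega> by (auto intro: finite_subset)
  then have "AE \<omega> in M. \<forall>p\<in>{1..J} \<times> \<Omega>. (case p of (i, n) \<Rightarrow> x i \<omega> n \<noteq> 0)"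
  proof (rule AE_finite_allI)
    fix p assume "p \<in> {1..J} \<times> \<Omega>"
    then have "distributed M lborel (\<lambda>\<omega>. x (fst p) \<omega> (snd p)) (normal_density 0 \<sigma>)"
      using ens by (auto simp: jsm2_ensemble_def iid_gaussian_def)
    from AE_normal_neq[OF this, of 0] show "AE \<omega> in M. case p of (i, n) \<Rightarrow> x i \<omega> n \<noteq> 0"
      by (simp add: case_prod_beta)
  qed
  then show ?thesis
    using AE_space
  proof eventually_elim
    case (elim \<omega>)
    have "\<exists>x'. (\<forall>i\<in>{1..J}. {n. x' i n \<noteq> 0} = \<Omega>) \<and> x' j \<noteq> x j \<omega> \<and>
        (\<forall>i\<in>{1..J}. \<forall>k\<in>{1..m i}. measure_vec N (\<Phi> i \<omega>) (x' i) k = measure_vec N (\<Phi> i \<omega>) (x i \<omega>) k)"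
      using elim ens by (intro another_ensemble[where M = m, OF \<Omega> j]) (auto simp: jsm2_ensemble_def)
    then show ?case
      using \<Omega> by blast
  qed
qed

section \<open>The expected gap of the Trivial Pursuit statistic\<close>

text \<open>The Cauchy-Schwarz bound for the square of a sum, used twice: squaring the first bound
  gives two factors \<open>card I\<close>, the second use gives one more.\<close>

lemma sum_power4_le:
  fixes f :: "'i \<Rightarrow> real"
  shows "(\<Sum>i\<in>I. f i) ^ 4 \<le> real (card I) ^ 3 * (\<Sum>i\<in>I. f i ^ 4)"
proof -
  have sq: "(\<Sum>i\<in>I. g i)\<^sup>2 \<le> real (card I) * (\<Sum>i\<in>I. (g i)\<^sup>2)" for g :: "'i \<Rightarrow> real"
    using sum_squared_le_sum_of_squares[of g I] by (simp add: mult.commute)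
  have "(\<Sum>i\<in>I. f i) ^ 4 = ((\<Sum>i\<in>I. f i)\<^sup>2)\<^sup>2"
    by simp
  also have "\<dots> \<le> (real (card I) * (\<Sum>i\<in>I. (f i)\<^sup>2))\<^sup>2"
    using sq[of f] by (intro power_mono) auto
  also have "\<dots> = (real (card I))\<^sup>2 * (\<Sum>i\<in>I. (f i)\<^sup>2)\<^sup>2"
    by (rule power_mult_distrib)
  also have "\<dots> \<le> (real (card I))\<^sup>2 * (real (card I) * (\<Sum>i\<in>I. ((f i)\<^sup>2)\<^sup>2))"
    by (intro mult_left_mono sq) auto
  also have "\<dots> = real (card I) ^ 3 * (\<Sum>i\<in>I. f i ^ 4)"
    by (simp add: power3_eq_cube power2_eq_square[of "real (card I)"])
  finally show ?thesis .
qed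

text \<open>The cross terms of the expanded square are nonnegative. This yields the lower bound for
  the fourth moment of the norm of a column.\<close>

lemma sum_power4_le_square_sum_squares:
  fixes f :: "'i \<Rightarrow> real"
  assumes "finite I"
  shows "(\<Sum>i\<in>I. f i ^ 4) \<le> (\<Sum>i\<in>I. f i * f i)\<^sup>2"
proof -
  have "f i * f i \<le> (\<Sum>i\<in>I. f i * f i)" if "i \<in> I" for i
    using assms that by (intro member_le_sum) auto
  then have "(\<Sum>i\<in>I. (f i * f i) * (f i * f i)) \<le> (\<Sum>i\<in>I. (f i * f i) * (\<Sum>i\<in>I. f i * f i))"
    by (intro sum_mono mult_left_mono) auto
  then show ?thesis
    by (simp add: sum_distrib_right power2_eq_square power4_eq_xxxx mult.assoc)
qed

text \<open>The product is at most the cube of the largest factor, and \<open>12 = 3 * 4\<close>.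
  Only moments of single variables remain, so factors that coincide, as two matrix entries do for
  \<open>l = n\<close>, cause no case distinction.\<close>

lemma triple_product_power4_le:
  fixes a b c :: real
  shows "(a * (b * c)) ^ 4 \<le> a ^ 12 + b ^ 12 + c ^ 12"
proof -
  define m where "m = max \<bar>a\<bar> (max \<bar>b\<bar> \<bar>c\<bar>)"
  have "\<bar>a\<bar> * (\<bar>b\<bar> * \<bar>c\<bar>) \<le> m * (m * m)"
    by (intro mult_mono) (auto simp: m_def)
  then have "(\<bar>a\<bar> * (\<bar>b\<bar> * \<bar>c\<bar>)) ^ 4 \<le> (m * (m * m)) ^ 4"
    by (intro power_mono) auto
  also have "(m * (m * m)) ^ 4 = m ^ 12"
    by (simp add: power_mult_distrib flip: power_add)
  also have "\<dots> \<le> \<bar>a\<bar> ^ 12 + \<bar>b\<bar> ^ 12 + \<bar>c\<bar> ^ 12"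
    by (simp add: m_def max_def)
  finally show ?thesis
    by (simp add: abs_mult power_mult_distrib)
qed

text \<open>The twelfth moment of a centred Gaussian with standard deviation \<open>s\<close>, that
  is \<open>10395 * s ^ 12\<close>.\<close>

definition gaussian_moment12 :: "real \<Rightarrow> real" where
  "gaussian_moment12 s = fact 12 / ((2 / s\<^sup>2) ^ 6 * fact 6)"

text \<open>The next two functions act on a point \<open>w\<close> of the joint sample space: \<open>w (None, j, n)\<close> is the
  signal coefficient \<open>x\<^sub>j(n)\<close> and \<open>w (Some j, m, n)\<close> the matrix entry \<open>\<Phi>\<^sub>j(m, n)\<close>. They are the
  inner products of two columns of \<open>\<Phi>\<^sub>j\<close>, and of \<open>y\<^sub>j\<close> with a column.\<close>

definition corr :: "nat \<Rightarrow> nat \<Rightarrow> (nat option \<times> nat \<times> nat \<Rightarrow> real) \<Rightarrow> nat \<Rightarrow> nat \<Rightarrow> real" where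
  "corr r j w l n = (\<Sum>m=1..r. w (Some j, m, l) * w (Some j, m, n))"

definition score :: "nat \<Rightarrow> nat set \<Rightarrow> nat \<Rightarrow> (nat option \<times> nat \<times> nat \<Rightarrow> real) \<Rightarrow> nat \<Rightarrow> real" where
  "score r \<Omega> j w n = (\<Sum>l\<in>\<Omega>. w (None, j, l) * corr r j w l n)"

lemma corr_cong:
  "(\<And>m. m \<in> {1..r} \<Longrightarrow> w (Some j, m, l) = w' (Some j, m, l)) \<Longrightarrow>
   (\<And>m. m \<in> {1..r} \<Longrightarrow> w (Some j, m, n) = w' (Some j, m, n)) \<Longrightarrow>
   corr r j w l n = corr r j w' l n"
  unfolding corr_def by (intro sum.cong) auto

lemma score_cong:
  "(\<And>l. l \<in> \<Omega> \<Longrightarrow> w (None, j, l) = w' (None, j, l)) \<Longrightarrow>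
   (\<And>l. l \<in> \<Omega> \<Longrightarrow> corr r j w l n = corr r j w' l n) \<Longrightarrow>
   score r \<Omega> j w n = score r \<Omega> j w' n"
  unfolding score_def by (intro sum.cong) auto

lemma borel_measurable_corr:
  assumes "\<And>m. m \<in> {1..r} \<Longrightarrow> (\<lambda>\<omega>. w \<omega> (Some j, m, l)) \<in> borel_measurable A"
    and "\<And>m. m \<in> {1..r} \<Longrightarrow> (\<lambda>\<omega>. w \<omega> (Some j, m, n)) \<in> borel_measurable A"
  shows "(\<lambda>\<omega>. corr r j (w \<omega>) l n) \<in> borel_measurable A"
  unfolding corr_def by (intro borel_measurable_sum borel_measurable_times assms)

lemma borel_measurable_score:
  assumes "\<And>l. l \<in> \<Omega> \<Longrightarrow> (\<lambda>\<omega>. w \<omega> (None, j, l)) \<in> borel_measurable A"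
    and "\<And>l. l \<in> \<Omega> \<Longrightarrow> (\<lambda>\<omega>. corr r j (w \<omega>) l n) \<in> borel_measurable A"
  shows "(\<lambda>\<omega>. score r \<Omega> j (w \<omega>) n) \<in> borel_measurable A"
  unfolding score_def by (intro borel_measurable_sum borel_measurable_times assms)

section \<open>The signals and matrices of one ensemble as a single independent Gaussian
  family\<close>

locale gaussian_ensemble = prob_space P for P :: "'a measure" +
  fixes J N :: nat and \<Omega> :: "nat set" and \<sigma> \<tau> :: real and M :: "nat \<Rightarrow> nat"
    and x :: "nat \<Rightarrow> 'a \<Rightarrow> nat \<Rightarrow> real" and \<Phi> :: "nat \<Rightarrow> 'a \<Rightarrow> nat \<Rightarrow> nat \<Rightarrow> real"
  assumes \<Omega>_subset: "\<Omega> \<subseteq> {1..N}" and \<sigma>_pos: "\<sigma> > 0" and \<tau>_pos: "\<tau> > 0"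
    and ensemble: "jsm2_ensemble P J N \<Omega> \<sigma> M x \<Phi>"
    and gaussian: "\<And>j. j \<in> {1..J} \<Longrightarrow>
      iid_gaussian P \<tau> ({1..M j} \<times> {1..N}) (\<lambda>(m, n) \<omega>. \<Phi> j \<omega> m n)"
begin

definition W :: "nat option \<times> nat \<times> nat \<Rightarrow> 'a \<Rightarrow> real" where
  "W p \<omega> = (case fst p of
     None \<Rightarrow> x (fst (snd p)) \<omega> (snd (snd p))
   | Some j \<Rightarrow> \<Phi> j \<omega> (fst (snd p)) (snd (snd p)))"

definition block :: "nat option \<Rightarrow> (nat \<times> nat) set" where
  "block i = (case i of None \<Rightarrow> {1..J} \<times> \<Omega> | Some j \<Rightarrow> {1..M j} \<times> {1..N})"

definition T :: "(nat option \<times> nat \<times> nat) set" where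
  "T = Sigma (insert None (Some ` {1..J})) block"

lemma finite_\<Omega>: "finite \<Omega>"
  using \<Omega>_subset by (rule finite_subset) simp

lemma None_in_T: "(None, j, l) \<in> T \<longleftrightarrow> j \<in> {1..J} \<and> l \<in> \<Omega>"
  by (auto simp: T_def block_def)

lemma Some_in_T: "(Some j, m, n) \<in> T \<longleftrightarrow> j \<in> {1..J} \<and> m \<in> {1..M j} \<and> n \<in> {1..N}"
  by (auto simp: T_def block_def)

text \<open>The outer layer is the mutual independence of the signal array and the matrices; the
  inner layer is the i.i.d. hypothesis on each of them.\<close>

lemma W_indep: "indep_vars (\<lambda>_. borel) W T"
proof -
  have "indep_vars (\<lambda>(i, k). borel) W (Sigma (insert None (Some ` {1..J})) block)"
  proof (rule indep_vars_nested)
    have "indep_vars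
       (\<lambda>i. case i of
          None \<Rightarrow> PiM ({1..J} \<times> \<Omega>) (\<lambda>_. borel)
        | Some j \<Rightarrow> PiM ({1..M j} \<times> {1..N}) (\<lambda>_. borel))
       (\<lambda>i \<omega>. case i of
          None \<Rightarrow> (\<lambda>(j, n)\<in>{1..J} \<times> \<Omega>. x j \<omega> n)
        | Some j \<Rightarrow> (\<lambda>(m, n)\<in>{1..M j} \<times> {1..N}. \<Phi> j \<omega> m n))
       (insert None (Some ` {1..J}))"
      using ensemble by (simp add: jsm2_ensemble_def)
    then show "indep_vars (\<lambda>i. Pi\<^sub>M (block i) (\<lambda>_. borel)) (\<lambda>i \<omega>. \<lambda>k\<in>block i. W (i, k) \<omega>)
        (insert None (Some ` {1..J}))"
      by (rule indep_vars_cong[THEN iffD1, rotated -1])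
        (auto simp: block_def W_def fun_eq_iff restrict_def split: option.split)
  next
    fix i assume i: "i \<in> insert None (Some ` {1..J})"
    show "finite (block i)"
      using finite_\<Omega> by (auto simp: block_def split: option.split)
    show "indep_vars (\<lambda>_. borel) (\<lambda>k. W (i, k)) (block i)"
    proof (cases i)
      case None
      have "indep_vars (\<lambda>_. borel) (\<lambda>(j, n) \<omega>. x j \<omega> n) ({1..J} \<times> \<Omega>)"
        using ensemble by (simp add: jsm2_ensemble_def iid_gaussian_def)
      then show ?thesis
        using None by (simp add: block_def W_def[abs_def] case_prod_beta')
    next
      case (Some j)
      then have "indep_vars (\<lambda>_. borel) (\<lambda>(m, n) \<omega>. \<Phi> j \<omega> m n) ({1..M j} \<times> {1..N})"
        using gaussian[of j] i by (auto simp: iid_gaussian_def)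
      then show ?thesis
        using Some by (simp add: block_def W_def[abs_def] case_prod_beta')
    qed
  qed
  then show ?thesis
    by (simp add: T_def case_prod_beta')
qed

lemma W_normal_None: "(None, j, l) \<in> T \<Longrightarrow> distributed P lborel (W (None, j, l)) (normal_density 0 \<sigma>)"
  using ensemble by (auto simp: None_in_T jsm2_ensemble_def iid_gaussian_def W_def[abs_def])

lemma W_normal_Some: "(Some j, m, n) \<in> T \<Longrightarrow> distributed P lborel (W (Some j, m, n)) (normal_density 0 \<tau>)"
  using gaussian[of j] by (auto simp: Some_in_T iid_gaussian_def W_def[abs_def])

lemma W_moments: "p \<in> T \<Longrightarrow> all_moments P (W p)"
  using all_moments_normal[OF \<sigma>_pos W_normal_None] all_moments_normal[OF \<tau>_pos W_normal_Some]
  by (metis not_None_eq prod.collapse)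

lemma W_mean: "p \<in> T \<Longrightarrow> expectation (W p) = 0"
  using normal_mean[OF \<sigma>_pos W_normal_None] normal_mean[OF \<tau>_pos W_normal_Some]
  by (metis not_None_eq prod.collapse)

lemmas W_square_None = normal_second_moment[OF \<sigma>_pos W_normal_None]
lemmas W_square_Some = normal_second_moment[OF \<tau>_pos W_normal_Some]

lemma W_moment12_None: "(None, j, l) \<in> T \<Longrightarrow> expectation (\<lambda>\<omega>. W (None, j, l) \<omega> ^ 12) = gaussian_moment12 \<sigma>"
  using normal_even_moment[OF \<sigma>_pos W_normal_None, of j l 6] by (simp add: gaussian_moment12_def)

lemma W_moment12_Some:
  "(Some j, m, n) \<in> T \<Longrightarrow> expectation (\<lambda>\<omega>. W (Some j, m, n) \<omega> ^ 12) = gaussian_moment12 \<tau>"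
  using normal_even_moment[OF \<tau>_pos W_normal_Some, of j m n 6] by (simp add: gaussian_moment12_def)

lemma corr_moments:
  "j \<in> {1..J} \<Longrightarrow> l \<in> {1..N} \<Longrightarrow> n \<in> {1..N} \<Longrightarrow> all_moments P (\<lambda>\<omega>. corr (M j) j (\<lambda>p. W p \<omega>) l n)"
  unfolding corr_def by (intro all_moments_sum all_moments_mult W_moments) (auto simp: Some_in_T)

lemma score_moments:
  "j \<in> {1..J} \<Longrightarrow> n \<in> {1..N} \<Longrightarrow> all_moments P (\<lambda>\<omega>. score (M j) \<Omega> j (\<lambda>p. W p \<omega>) n)"
  unfolding score_def using \<Omega>_subset
  by (intro all_moments_sum all_moments_mult W_moments corr_moments) (auto simp: None_in_T)

lemma corr_square_offdiag:
  assumes j: "j \<in> {1..J}" and "l \<in> {1..N}" "n \<in> {1..N}" "l \<noteq> n"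
  shows "expectation (\<lambda>\<omega>. (corr (M j) j (\<lambda>p. W p \<omega>) l n)\<^sup>2) = real (M j) * \<tau> ^ 4"
proof -
  \<comment> \<open>Column \<open>n\<close> supplies the coefficients and column \<open>l\<close>
    the centred factors. They are disjoint as \<open>l \<noteq> n\<close>, so every row contributes
    \<open>\<tau>\<^sup>2 * \<tau>\<^sup>2\<close>.\<close>
  define B where "B = {Some j} \<times> ({1..M j} \<times> {n})"
  have "corr (M j) j (\<lambda>p. W p \<omega>) l n =
      (\<Sum>m\<in>{1..M j}. W (Some j, m, l) \<omega> * (\<lambda>s\<in>B. W s \<omega>) (Some j, m, n))" for \<omega>
    unfolding corr_def by (intro sum.cong) (auto simp: B_def)
  then have "expectation (\<lambda>\<omega>. (corr (M j) j (\<lambda>p. W p \<omega>) l n)\<^sup>2) =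
      expectation (\<lambda>\<omega>. (\<Sum>m\<in>{1..M j}. W (Some j, m, l) \<omega> * (\<lambda>s\<in>B. W s \<omega>) (Some j, m, n))\<^sup>2)"
    by (simp only:)
  also have "\<dots> = (\<Sum>m\<in>{1..M j}. expectation (\<lambda>\<omega>. (W (Some j, m, l) \<omega>)\<^sup>2) *
      expectation (\<lambda>\<omega>. ((\<lambda>s\<in>B. W s \<omega>) (Some j, m, n))\<^sup>2))"
  proof (rule second_moment_indep_combination[OF W_indep,
        where t = "\<lambda>m. (Some j, m, l)" and g = "\<lambda>m w. w (Some j, m, n)" and B = B])
    fix m assume m: "m \<in> {1..M j}"
    then have mB: "(Some j, m, n) \<in> B"
      by (auto simp: B_def)
    then show "(\<lambda>w. w (Some j, m, n)) \<in> borel_measurable (PiM B (\<lambda>_. borel))"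
      by (rule measurable_component_singleton)
    show "all_moments P (\<lambda>\<omega>. (\<lambda>s\<in>B. W s \<omega>) (Some j, m, n))"
      using mB m assms by (simp add: W_moments Some_in_T)
    show "all_moments P (W (Some j, m, l))" "expectation (W (Some j, m, l)) = 0"
      using m assms by (simp_all add: W_moments W_mean Some_in_T)
  qed (use assms in \<open>auto simp: B_def Some_in_T inj_on_def\<close>)
  also have "\<dots> = (\<Sum>m\<in>{1..M j}. \<tau>\<^sup>2 * \<tau>\<^sup>2)"
    using assms by (intro sum.cong) (auto simp: W_square_Some B_def Some_in_T)
  finally show ?thesis
    by (simp add: power2_eq_square power4_eq_xxxx)
qed

text \<open>Each row contributes a fourth moment \<open>3 * \<tau> ^ 4\<close>, and the mixed terms
  only help. The exact value is \<open>M j * (M j + 2) * \<tau> ^ 4\<close>; a bound linear in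
  \<open>M j\<close> already beats the off-diagonal value.\<close>

lemma corr_square_diag:
  assumes j: "j \<in> {1..J}" and n: "n \<in> {1..N}"
  shows "expectation (\<lambda>\<omega>. (corr (M j) j (\<lambda>p. W p \<omega>) n n)\<^sup>2) \<ge> 3 * real (M j) * \<tau> ^ 4"
proof -
  have "3 * real (M j) * \<tau> ^ 4 = (\<Sum>m\<in>{1..M j}. expectation (\<lambda>\<omega>. W (Some j, m, n) \<omega> ^ 4))"
    using assms by (simp add: normal_fourth_moment[OF \<tau>_pos W_normal_Some] Some_in_T)
  also have "\<dots> = expectation (\<lambda>\<omega>. \<Sum>m\<in>{1..M j}. W (Some j, m, n) \<omega> ^ 4)"
    using assms by (intro Bochner_Integration.integral_sum[symmetric] all_moments_integrable all_moments_power W_moments)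
      (auto simp: Some_in_T)
  also have "\<dots> \<le> expectation (\<lambda>\<omega>. (corr (M j) j (\<lambda>p. W p \<omega>) n n)\<^sup>2)"
    using assms unfolding corr_def
    by (intro integral_mono all_moments_integrable all_moments_power all_moments_sum all_moments_mult
        W_moments sum_power4_le_square_sum_squares) (auto simp: Some_in_T)
  finally show ?thesis .
qed

text \<open>The coefficients of signal \<open>j\<close> are centred, mutually independent and
  independent of matrix \<open>j\<close>. Hence the terms for different \<open>l\<close> are
  orthogonal, although the column products they multiply share the entries of column
  \<open>n\<close>.\<close>

lemma score_square:
  assumes j: "j \<in> {1..J}" and n: "n \<in> {1..N}"
  shows "expectation (\<lambda>\<omega>. (score (M j) \<Omega> j (\<lambda>p. W p \<omega>) n)\<^sup>2) =
    \<sigma>\<^sup>2 * (\<Sum>l\<in>\<Omega>. expectation (\<lambda>\<omega>. (corr (M j) j (\<lambda>p. W p \<omega>) l n)\<^sup>2))"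
proof -
  define B where "B = {Some j} \<times> ({1..M j} \<times> {1..N})"
  have corr_restrict: "corr (M j) j (\<lambda>s\<in>B. W s \<omega>) l n = corr (M j) j (\<lambda>p. W p \<omega>) l n" if "l \<in> \<Omega>" for \<omega> l
    using that \<Omega>_subset n by (intro corr_cong) (auto simp: B_def)
  have "score (M j) \<Omega> j (\<lambda>p. W p \<omega>) n =
      (\<Sum>l\<in>\<Omega>. W (None, j, l) \<omega> * corr (M j) j (\<lambda>s\<in>B. W s \<omega>) l n)" for \<omega>
    unfolding score_def by (intro sum.cong) (auto simp: corr_restrict)
  then have "expectation (\<lambda>\<omega>. (score (M j) \<Omega> j (\<lambda>p. W p \<omega>) n)\<^sup>2) =
      expectation (\<lambda>\<omega>. (\<Sum>l\<in>\<Omega>. W (None, j, l) \<omega> * corr (M j) j (\<lambda>s\<in>B. W s \<omega>) l n)\<^sup>2)"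
    by (simp only:)
  also have "\<dots> = (\<Sum>l\<in>\<Omega>. expectation (\<lambda>\<omega>. (W (None, j, l) \<omega>)\<^sup>2) *
      expectation (\<lambda>\<omega>. (corr (M j) j (\<lambda>s\<in>B. W s \<omega>) l n)\<^sup>2))"
  proof (rule second_moment_indep_combination[OF W_indep,
        where t = "\<lambda>l. (None, j, l)" and g = "\<lambda>l w. corr (M j) j w l n" and B = B])
    fix l assume l: "l \<in> \<Omega>"
    then have lN: "l \<in> {1..N}"
      using \<Omega>_subset by auto
    show "(\<lambda>w. corr (M j) j w l n) \<in> borel_measurable (PiM B (\<lambda>_. borel))"
      using lN n by (intro borel_measurable_corr measurable_component_singleton) (auto simp: B_def)
    show "all_moments P (\<lambda>\<omega>. corr (M j) j (\<lambda>s\<in>B. W s \<omega>) l n)"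
      using corr_moments[OF j lN n] by (simp only: corr_restrict[OF l])
    show "all_moments P (W (None, j, l))" "expectation (W (None, j, l)) = 0"
      using l j by (simp_all add: W_moments W_mean None_in_T)
  qed (use j finite_\<Omega> in \<open>auto simp: B_def Some_in_T None_in_T inj_on_def\<close>)
  also have "\<dots> = (\<Sum>l\<in>\<Omega>. \<sigma>\<^sup>2 * expectation (\<lambda>\<omega>. (corr (M j) j (\<lambda>p. W p \<omega>) l n)\<^sup>2))"
    using j by (intro sum.cong) (auto simp: W_square_None None_in_T corr_restrict)
  finally show ?thesis
    by (simp add: sum_distrib_left)
qed

text \<open>Only the diagonal term \<open>l = n\<close> distinguishes an index \<open>n\<close> of the support from an index
  outside it: \<open>E \<parallel>\<phi>\<^sub>n\<parallel>\<^sup>4\<close> replaces \<open>E \<langle>\<phi>\<^sub>n, \<phi>\<^sub>k\<rangle>\<^sup>2\<close>.\<close>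

lemma score_gap:
  assumes j: "j \<in> {1..J}" and n: "n \<in> \<Omega>" and k: "k \<in> {1..N} - \<Omega>"
  shows "expectation (\<lambda>\<omega>. (score (M j) \<Omega> j (\<lambda>p. W p \<omega>) n)\<^sup>2 - (score (M j) \<Omega> j (\<lambda>p. W p \<omega>) k)\<^sup>2)
    \<ge> 2 * \<sigma>\<^sup>2 * real (M j) * \<tau> ^ 4"
proof -
  define e where "e l i = expectation (\<lambda>\<omega>. (corr (M j) j (\<lambda>p. W p \<omega>) l i)\<^sup>2)" for l i
  define q where "q = real (M j) * \<tau> ^ 4"
  have nN: "n \<in> {1..N}" and kN: "k \<in> {1..N}"
    using n k \<Omega>_subset by auto
  have off: "e l i = q" if "l \<in> \<Omega>" "i \<in> {1..N}" "l \<noteq> i" for l i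
    unfolding e_def q_def using that \<Omega>_subset by (intro corr_square_offdiag j) auto
  have "(\<Sum>l\<in>\<Omega>. e l n) = e n n + (\<Sum>l\<in>\<Omega> - {n}. q)"
    using finite_\<Omega> n nN by (subst sum.remove[of _ n]) (auto simp: off)
  moreover have "(\<Sum>l\<in>\<Omega>. e l k) = (\<Sum>l\<in>\<Omega>. q)"
    using k kN by (intro sum.cong refl off) auto
  moreover have "(\<Sum>l\<in>\<Omega>. q) = q + (\<Sum>l\<in>\<Omega> - {n}. q)"
    by (rule sum.remove[OF finite_\<Omega> n])
  \<comment> \<open>The surplus \<open>2 * q\<close> is this \<open>3 * q\<close> minus the single
    \<open>q\<close> that the other index has in its place; all remaining terms cancel.\<close>
  moreover have "e n n \<ge> 3 * q"
    using corr_square_diag[OF j nN] by (simp add: e_def q_def)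
  ultimately have "(\<Sum>l\<in>\<Omega>. e l n) - (\<Sum>l\<in>\<Omega>. e l k) \<ge> 2 * q"
    by simp
  then have "\<sigma>\<^sup>2 * (2 * q) \<le> \<sigma>\<^sup>2 * ((\<Sum>l\<in>\<Omega>. e l n) - (\<Sum>l\<in>\<Omega>. e l k))"
    by (intro mult_left_mono) auto
  also have "\<dots> = expectation (\<lambda>\<omega>. (score (M j) \<Omega> j (\<lambda>p. W p \<omega>) n)\<^sup>2) -
      expectation (\<lambda>\<omega>. (score (M j) \<Omega> j (\<lambda>p. W p \<omega>) k)\<^sup>2)"
    unfolding score_square[OF j nN] score_square[OF j kN] e_def by (rule right_diff_distrib)
  also have "\<dots> = expectation (\<lambda>\<omega>. (score (M j) \<Omega> j (\<lambda>p. W p \<omega>) n)\<^sup>2 - (score (M j) \<Omega> j (\<lambda>p. W p \<omega>) k)\<^sup>2)"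
    by (intro Bochner_Integration.integral_diff[symmetric] all_moments_integrable all_moments_power
        score_moments j nN kN)
  finally show ?thesis
    by (simp add: q_def mult_ac)
qed

text \<open>The score is a sum of \<open>card \<Omega> * M j\<close> products of three Gaussians.
  The fourth-power bound costs the cube of that number, and adding up the terms costs one more
  factor.\<close>

lemma score_fourth:
  assumes j: "j \<in> {1..J}" and n: "n \<in> {1..N}"
  shows "expectation (\<lambda>\<omega>. score (M j) \<Omega> j (\<lambda>p. W p \<omega>) n ^ 4) \<le>
    real (card \<Omega> * M j) ^ 4 * (gaussian_moment12 \<sigma> + 2 * gaussian_moment12 \<tau>)"
proof -
  define I where "I = \<Omega> \<times> {1..M j}"
  define t where "t p \<omega> = W (None, j, fst p) \<omega> * (W (Some j, snd p, fst p) \<omega> * W (Some j, snd p, n) \<omega>)"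
    for p \<omega>
  have card: "card I = card \<Omega> * M j"
    by (simp add: I_def card_cartesian_product)
  have inT: "(None, j, fst p) \<in> T" "(Some j, snd p, fst p) \<in> T" "(Some j, snd p, n) \<in> T" if "p \<in> I" for p
    using that j n \<Omega>_subset by (auto simp: I_def None_in_T Some_in_T)
  have mt: "all_moments P (t p)" if "p \<in> I" for p
    unfolding t_def by (intro all_moments_mult W_moments inT that)
  have score: "score (M j) \<Omega> j (\<lambda>p. W p \<omega>) n = (\<Sum>p\<in>I. t p \<omega>)" for \<omega>
    by (simp add: score_def corr_def sum_distrib_left I_def t_def sum.cartesian_product case_prod_beta')
  have t4: "expectation (\<lambda>\<omega>. t p \<omega> ^ 4) \<le> gaussian_moment12 \<sigma> + 2 * gaussian_moment12 \<tau>" if p: "p \<in> I" for p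
  proof -
    have "expectation (\<lambda>\<omega>. t p \<omega> ^ 4) \<le> expectation (\<lambda>\<omega>. W (None, j, fst p) \<omega> ^ 12 +
        W (Some j, snd p, fst p) \<omega> ^ 12 + W (Some j, snd p, n) \<omega> ^ 12)"
      using triple_product_power4_le
      by (intro integral_mono all_moments_integrable all_moments_add all_moments_power mt p W_moments inT)
        (simp_all add: t_def)
    also have "\<dots> = expectation (\<lambda>\<omega>. W (None, j, fst p) \<omega> ^ 12) +
        expectation (\<lambda>\<omega>. W (Some j, snd p, fst p) \<omega> ^ 12) + expectation (\<lambda>\<omega>. W (Some j, snd p, n) \<omega> ^ 12)"
      by (simp add: all_moments_integrable all_moments_add all_moments_power W_moments inT[OF p])
    finally show ?thesis
      using inT[OF p] by (simp add: W_moment12_None W_moment12_Some)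
  qed
  have "expectation (\<lambda>\<omega>. score (M j) \<Omega> j (\<lambda>p. W p \<omega>) n ^ 4) \<le>
      expectation (\<lambda>\<omega>. real (card I) ^ 3 * (\<Sum>p\<in>I. t p \<omega> ^ 4))"
    unfolding score
    by (intro integral_mono sum_power4_le all_moments_integrable all_moments_mult all_moments_const
        all_moments_power all_moments_sum mt)
  also have "\<dots> = real (card I) ^ 3 * (\<Sum>p\<in>I. expectation (\<lambda>\<omega>. t p \<omega> ^ 4))"
    by (simp add: Bochner_Integration.integral_sum all_moments_integrable all_moments_power mt)
  also have "\<dots> \<le> real (card I) ^ 3 * (\<Sum>p\<in>I. gaussian_moment12 \<sigma> + 2 * gaussian_moment12 \<tau>)"
    by (intro mult_left_mono sum_mono t4) auto
  also have "\<dots> = real (card \<Omega> * M j) ^ 4 * (gaussian_moment12 \<sigma> + 2 * gaussian_moment12 \<tau>)"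
    by (simp add: card power4_eq_xxxx power3_eq_cube)
  finally show ?thesis .
qed

section \<open>The contribution of one sensor to the difference of two statistics\<close>

definition diff_stat :: "nat \<Rightarrow> nat \<Rightarrow> nat \<Rightarrow> 'a \<Rightarrow> real" where
  "diff_stat n k j \<omega> =
    (score (M j) \<Omega> j (\<lambda>p. W p \<omega>) n)\<^sup>2 - (score (M j) \<Omega> j (\<lambda>p. W p \<omega>) k)\<^sup>2"

lemma diff_stat_moments:
  "j \<in> {1..J} \<Longrightarrow> n \<in> {1..N} \<Longrightarrow> k \<in> {1..N} \<Longrightarrow> all_moments P (diff_stat n k j)"
  unfolding diff_stat_def by (intro all_moments_diff all_moments_power score_moments)

lemma diff_stat_square:
  assumes j: "j \<in> {1..J}" and n: "n \<in> {1..N}" and k: "k \<in> {1..N}"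
  shows "expectation (\<lambda>\<omega>. (diff_stat n k j \<omega>)\<^sup>2) \<le>
    2 * real (card \<Omega> * M j) ^ 4 * (gaussian_moment12 \<sigma> + 2 * gaussian_moment12 \<tau>)"
proof -
  \<comment> \<open>Dropping the negative cross term leaves one fourth moment per index, hence the
    factor 2 in the bound.\<close>
  have "(a\<^sup>2 - b\<^sup>2)\<^sup>2 \<le> a ^ 4 + b ^ 4" for a b :: real
  proof -
    have "(a\<^sup>2 - b\<^sup>2)\<^sup>2 = a ^ 4 + b ^ 4 - 2 * (a * b)\<^sup>2"
      by (simp add: power2_eq_square power4_eq_xxxx algebra_simps)
    then show ?thesis
      by simp
  qed
  then have "expectation (\<lambda>\<omega>. (diff_stat n k j \<omega>)\<^sup>2) \<le>
      expectation (\<lambda>\<omega>. score (M j) \<Omega> j (\<lambda>p. W p \<omega>) n ^ 4 + score (M j) \<Omega> j (\<lambda>p. W p \<omega>) k ^ 4)"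
    unfolding diff_stat_def
    by (intro integral_mono all_moments_integrable all_moments_add all_moments_diff all_moments_power
        score_moments assms)
  also have "\<dots> = expectation (\<lambda>\<omega>. score (M j) \<Omega> j (\<lambda>p. W p \<omega>) n ^ 4) +
      expectation (\<lambda>\<omega>. score (M j) \<Omega> j (\<lambda>p. W p \<omega>) k ^ 4)"
    by (intro Bochner_Integration.integral_add all_moments_integrable all_moments_power score_moments assms)
  finally show ?thesis
    using score_fourth[OF j n] score_fourth[OF j k] by linarith
qed

text \<open>Sensor \<open>j\<close> reads only signal \<open>j\<close> and matrix \<open>j\<close>,
  and these groups are disjoint. The coefficients of all signals share one block of the model, so
  the split is made on scalars and not on blocks.\<close>

lemma diff_stat_indep:
  assumes n: "n \<in> {1..N}" and k: "k \<in> {1..N}"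
  shows "indep_vars (\<lambda>_. borel) (diff_stat n k) {1..J}"
proof -
  define U where "U j = {None} \<times> ({j} \<times> \<Omega>) \<union> {Some j} \<times> ({1..M j} \<times> {1..N})" for j
  define h where "h j w = (score (M j) \<Omega> j w n)\<^sup>2 - (score (M j) \<Omega> j w k)\<^sup>2" for j w
  have h: "h j \<in> borel_measurable (PiM (U j) (\<lambda>_. borel))" for j
  proof -
    have "(\<lambda>w. score (M j) \<Omega> j w i) \<in> borel_measurable (PiM (U j) (\<lambda>_. borel))" if "i \<in> {1..N}" for i
      using that \<Omega>_subset
      by (intro borel_measurable_score borel_measurable_corr measurable_component_singleton) (auto simp: U_def)
    then show ?thesis
      unfolding h_def using n k by (intro borel_measurable_diff borel_measurable_power) auto
  qed
  have "indep_vars (\<lambda>_. borel) (\<lambda>j \<omega>. h j (\<lambda>s\<in>U j. W s \<omega>)) {1..J}"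
    by (rule indep_vars_compose2[OF indep_vars_restrict[OF W_indep] h])
      (auto simp: U_def None_in_T Some_in_T disjoint_family_on_def)
  moreover have "h j (\<lambda>s\<in>U j. W s \<omega>) = diff_stat n k j \<omega>" for j \<omega>
  proof -
    have "score (M j) \<Omega> j (\<lambda>s\<in>U j. W s \<omega>) i = score (M j) \<Omega> j (\<lambda>p. W p \<omega>) i" if "i \<in> {1..N}" for i
      using that \<Omega>_subset by (intro score_cong corr_cong) (auto simp: U_def)
    then show ?thesis
      using n k by (simp add: h_def diff_stat_def)
  qed
  ultimately show ?thesis
    by simp
qed

section \<open>The statistic and the recovery event of Trivial Pursuit\<close>

lemma x_eq_0: "j \<in> {1..J} \<Longrightarrow> \<omega> \<in> space P \<Longrightarrow> n \<notin> \<Omega> \<Longrightarrow> x j \<omega> n = 0"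
  using ensemble by (auto simp: jsm2_ensemble_def)

text \<open>The measurement is the combination of the columns in \<Omega> with the signal
  coefficients as weights; exchanging the two sums connects the algorithm to the joint
  family.\<close>

lemma inner_product_eq_score:
  assumes "j \<in> {1..J}" "\<omega> \<in> space P"
  shows "(\<Sum>m=1..M j. measure_vec N (\<Phi> j \<omega>) (x j \<omega>) m * \<Phi> j \<omega> m n) = score (M j) \<Omega> j (\<lambda>p. W p \<omega>) n"
proof -
  have "measure_vec N (\<Phi> j \<omega>) (x j \<omega>) m = (\<Sum>l\<in>\<Omega>. \<Phi> j \<omega> m l * x j \<omega> l)" for m
    using \<Omega>_subset x_eq_0[OF assms] by (intro measure_vec_eq_sum) auto
  then have "(\<Sum>m=1..M j. measure_vec N (\<Phi> j \<omega>) (x j \<omega>) m * \<Phi> j \<omega> m n) =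
      (\<Sum>m=1..M j. \<Sum>l\<in>\<Omega>. x j \<omega> l * (\<Phi> j \<omega> m l * \<Phi> j \<omega> m n))"
    by (simp add: sum_distrib_left mult_ac)
  also have "\<dots> = (\<Sum>l\<in>\<Omega>. \<Sum>m=1..M j. x j \<omega> l * (\<Phi> j \<omega> m l * \<Phi> j \<omega> m n))"
    by (rule sum.swap)
  finally show ?thesis
    by (simp add: score_def corr_def sum_distrib_left W_def)
qed

definition stat :: "'a \<Rightarrow> nat \<Rightarrow> real" where
  "stat \<omega> = tp_statistic J M (\<lambda>j. \<Phi> j \<omega>) (\<lambda>j. measure_vec N (\<Phi> j \<omega>) (x j \<omega>))"

lemma stat_eq:
  assumes "\<omega> \<in> space P"
  shows "stat \<omega> n = 1 / real J * (\<Sum>j=1..J. (score (M j) \<Omega> j (\<lambda>p. W p \<omega>) n)\<^sup>2)"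
  using inner_product_eq_score[OF _ assms] by (simp add: stat_def tp_statistic_def)

lemma stat_diff:
  "\<omega> \<in> space P \<Longrightarrow> stat \<omega> n - stat \<omega> k = 1 / real J * (\<Sum>j=1..J. diff_stat n k j \<omega>)"
  by (simp add: stat_eq diff_stat_def sum_subtractf diff_divide_distrib)

lemma stat_measurable: "n \<in> {1..N} \<Longrightarrow> (\<lambda>\<omega>. stat \<omega> n) \<in> borel_measurable P"
  by (subst measurable_cong[OF stat_eq], assumption)
    (intro borel_measurable_times borel_measurable_const borel_measurable_sum borel_measurable_power
      all_moments_measurable score_moments)

text \<open>Every quantifier now ranges over a finite set, and the atoms are comparisons of random
  variables. The measurability proof reads the event off this form.\<close>

lemma tp_recovers_iff:
  assumes \<omega>: "\<omega> \<in> space P" and M: "\<And>j. j \<in> {1..J} \<Longrightarrow> M j = card \<Omega>"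
  shows "tp_recovers J N (card \<Omega>) M (\<lambda>j. \<Phi> j \<omega>) (\<lambda>j. x j \<omega>) \<longleftrightarrow>
    (\<forall>S\<in>{S \<in> Pow {1..N}. card S = card \<Omega>}. (\<forall>n\<in>S. \<forall>k\<in>{1..N} - S. stat \<omega> k \<le> stat \<omega> n) \<longrightarrow>
      (\<forall>j\<in>{1..J}. (\<forall>n\<in>\<Omega> - S. x j \<omega> n = 0) \<and> Determinant.det (column_mat (\<Phi> j \<omega>) S) \<noteq> 0))"
proof -
  have "tp_estimates (M j) (\<Phi> j \<omega>) (measure_vec N (\<Phi> j \<omega>) (x j \<omega>)) S = {x j \<omega>} \<longleftrightarrow>
      (\<forall>n\<in>\<Omega> - S. x j \<omega> n = 0) \<and> Determinant.det (column_mat (\<Phi> j \<omega>) S) \<noteq> 0"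
    if "S \<subseteq> {1..N}" "card S = card \<Omega>" "j \<in> {1..J}" for S j
  proof -
    have "(\<forall>n. n \<notin> S \<longrightarrow> x j \<omega> n = 0) \<longleftrightarrow> (\<forall>n\<in>\<Omega> - S. x j \<omega> n = 0)"
      using x_eq_0[OF that(3) \<omega>] by auto
    then show ?thesis
      using tp_estimates_eq_singleton_iff[OF that(1)] M[OF that(3)] that(2) by simp
  qed
  then show ?thesis
    unfolding tp_recovers_def tp_support_def Let_def stat_def[symmetric] by auto
qed

lemma det_measurable:
  assumes "j \<in> {1..J}" "M j = card \<Omega>" "S \<subseteq> {1..N}" "card S = card \<Omega>"
  shows "(\<lambda>\<omega>. Determinant.det (column_mat (\<Phi> j \<omega>) S)) \<in> borel_measurable P"
  unfolding column_mat_def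
proof (rule borel_measurable_det)
  fix a b assume ab: "a < card S" "b < card S"
  have "finite S"
    using assms(3) by (rule finite_subset) simp
  then have "sorted_list_of_set S ! b \<in> S"
    using ab nth_mem[of b "sorted_list_of_set S"] by simp
  then have "W (Some j, Suc a, sorted_list_of_set S ! b) \<in> borel_measurable P"
    using ab assms by (intro all_moments_measurable W_moments) (auto simp: Some_in_T)
  then show "(\<lambda>\<omega>. \<Phi> j \<omega> (Suc a) (sorted_list_of_set S ! b)) \<in> borel_measurable P"
    by (simp add: W_def[abs_def])
qed

text \<open>\<open>measure\<close> is 0 on sets outside the sigma-algebra, so monotonicity can give
  a lower bound for the success probability only once this is known.\<close>

lemma tp_recovers_measurable:
  assumes M: "\<And>j. j \<in> {1..J} \<Longrightarrow> M j = card \<Omega>"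
  shows "{\<omega> \<in> space P. tp_recovers J N (card \<Omega>) M (\<lambda>j. \<Phi> j \<omega>) (\<lambda>j. x j \<omega>)} \<in> events"
proof -
  have xm: "(\<lambda>\<omega>. x j \<omega> n) \<in> borel_measurable P" if "j \<in> {1..J}" "n \<in> \<Omega>" for j n
    using all_moments_measurable[OF W_moments[of "(None, j, n)"]] that
    by (simp add: None_in_T W_def[abs_def])
  have "{\<omega> \<in> space P. \<forall>S\<in>{S \<in> Pow {1..N}. card S = card \<Omega>}.
      (\<forall>n\<in>S. \<forall>k\<in>{1..N} - S. stat \<omega> k \<le> stat \<omega> n) \<longrightarrow>
      (\<forall>j\<in>{1..J}. (\<forall>n\<in>\<Omega> - S. x j \<omega> n = 0) \<and> Determinant.det (column_mat (\<Phi> j \<omega>) S) \<noteq> 0)} \<in> events"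
  proof (intro sets.sets_Collect_finite_All sets.sets_Collect_imp sets.sets_Collect_conj)
    fix S assume S: "S \<in> {S \<in> Pow {1..N}. card S = card \<Omega>}"
    show "finite S"
      using S by (auto intro: finite_subset)
    show "{\<omega> \<in> space P. stat \<omega> k \<le> stat \<omega> n} \<in> events" if "n \<in> S" "k \<in> {1..N} - S" for n k
      using S that by (intro borel_measurable_le stat_measurable) auto
    show "{\<omega> \<in> space P. x j \<omega> n = 0} \<in> events" if "j \<in> {1..J}" "n \<in> \<Omega> - S" for j n
      using that by (intro borel_measurable_eq xm) auto
    show "{\<omega> \<in> space P. Determinant.det (column_mat (\<Phi> j \<omega>) S) \<noteq> 0} \<in> events" if "j \<in> {1..J}" for j
      using S M that by (intro borel_measurable_neq det_measurable) auto
  qed (use finite_\<Omega> in auto)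
  also have "?this \<longleftrightarrow> ?thesis"
    by (intro arg_cong[of _ _ "\<lambda>A. A \<in> events"] Collect_cong conj_cong refl) (simp only: tp_recovers_iff[OF _ M])
  finally show ?thesis .
qed

lemma AE_det_support_neq_0:
  assumes j: "j \<in> {1..J}" and "M j = card \<Omega>"
  shows "AE \<omega> in P. Determinant.det (column_mat (\<Phi> j \<omega>) \<Omega>) \<noteq> 0"
proof -
  define Y where "Y = (\<lambda>(m, n) \<omega>. \<Phi> j \<omega> m n)"
  have Y: "indep_vars (\<lambda>_. borel) Y ({1..M j} \<times> {1..N})"
    "\<And>t. t \<in> {1..M j} \<times> {1..N} \<Longrightarrow> distributed P lborel (Y t) (normal_density 0 \<tau>)"
    using gaussian[OF j] by (auto simp: iid_gaussian_def Y_def)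
  have "sorted_list_of_set \<Omega> ! b \<in> {1..N}" if "b < card \<Omega>" for b
    using that \<Omega>_subset finite_\<Omega> nth_mem[of b "sorted_list_of_set \<Omega>"] by auto
  then have "AE \<omega> in P. Determinant.det (mat (card \<Omega>) (card \<Omega>)
      (\<lambda>(a, b). Y (Suc a, sorted_list_of_set \<Omega> ! b) \<omega>)) \<noteq> 0"
    using assms AE_normal_neq[OF Y(2)] finite_\<Omega>
    by (intro AE_det_neq_0[OF Y(1)]) (auto simp: inj_on_def nth_eq_iff_index_eq)
  then show ?thesis
    by (simp add: Y_def column_mat_def)
qed

lemma prob_tp_recovers_ge:
  assumes M: "\<And>j. j \<in> {1..J} \<Longrightarrow> M j = card \<Omega>" and "J \<ge> 1"
  shows "prob {\<omega> \<in> space P. tp_recovers J N (card \<Omega>) M (\<lambda>j. \<Phi> j \<omega>) (\<lambda>j. x j \<omega>)} \<ge>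
    1 - real (card (\<Omega> \<times> ({1..N} - \<Omega>))) *
      (2 * real (card \<Omega> * card \<Omega>) ^ 4 * (gaussian_moment12 \<sigma> + 2 * gaussian_moment12 \<tau>) /
        (real J * (2 * \<sigma>\<^sup>2 * real (card \<Omega>) * \<tau> ^ 4)\<^sup>2))"
    (is "_ \<ge> 1 - real (card ?I) * ?b")
proof -
  define bad where "bad p = {\<omega> \<in> space P. (\<Sum>j=1..J. diff_stat (fst p) (snd p) j \<omega>) \<le> 0}" for p
  have inN: "fst p \<in> {1..N}" "snd p \<in> {1..N}" if "p \<in> ?I" for p
    using that \<Omega>_subset by auto
  have bad: "bad p \<in> events" if "p \<in> ?I" for p
  proof -
    have "(\<lambda>\<omega>. \<Sum>j=1..J. diff_stat (fst p) (snd p) j \<omega>) \<in> borel_measurable P"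
      using inN[OF that] by (intro borel_measurable_sum all_moments_measurable diff_stat_moments)
    then show ?thesis
      unfolding bad_def by measurable
  qed
  have "prob (bad p) \<le> ?b" if p: "p \<in> ?I" for p
  proof -
    \<comment> \<open>A pair in the index set provides an element of \<Omega>, which makes the lower
      bound on the mean strictly positive. For empty \<Omega> there is no bad event at all.\<close>
    have "card \<Omega> > 0"
      using p finite_\<Omega> by (auto simp: card_gt_0_iff)
    then have "prob (bad p) \<le> 2 * real (card \<Omega> * card \<Omega>) ^ 4 * (gaussian_moment12 \<sigma> + 2 * gaussian_moment12 \<tau>) /
        (real (card {1..J}) * (2 * \<sigma>\<^sup>2 * real (card \<Omega>) * \<tau> ^ 4)\<^sup>2)"
      unfolding bad_def
    proof (intro prob_sum_nonpos_le)
      show "indep_vars (\<lambda>_. borel) (diff_stat (fst p) (snd p)) {1..J}"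
        by (rule diff_stat_indep) (use inN[OF p] in auto)
      show "2 * \<sigma>\<^sup>2 * real (card \<Omega>) * \<tau> ^ 4 \<le> expectation (diff_stat (fst p) (snd p) j)"
        if "j \<in> {1..J}" for j
        using score_gap[OF that, of "fst p" "snd p"] M[OF that] p by (auto simp: diff_stat_def[abs_def])
      show "expectation (\<lambda>\<omega>. (diff_stat (fst p) (snd p) j \<omega>)\<^sup>2) \<le>
          2 * real (card \<Omega> * card \<Omega>) ^ 4 * (gaussian_moment12 \<sigma> + 2 * gaussian_moment12 \<tau>)"
        if "j \<in> {1..J}" for j
        using diff_stat_square[OF that inN[OF p]] M[OF that] by simp
    qed (use \<open>J \<ge> 1\<close> \<sigma>_pos \<tau>_pos inN[OF p] in \<open>auto intro: diff_stat_moments\<close>)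
    then show ?thesis
      by simp
  qed
  then have "(\<Sum>p\<in>?I. prob (bad p)) \<le> real (card ?I) * ?b"
    by (intro sum_bounded_above)
  moreover have "prob (\<Union>p\<in>?I. bad p) \<le> (\<Sum>p\<in>?I. prob (bad p))"
    using bad finite_\<Omega> by (intro finite_measure_subadditive_finite) auto
  moreover have "prob (space P - (\<Union>p\<in>?I. bad p)) = 1 - prob (\<Union>p\<in>?I. bad p)"
    using bad finite_\<Omega> by (intro prob_compl sets.finite_UN) auto
  moreover have "prob (space P - (\<Union>p\<in>?I. bad p)) \<le>
      prob {\<omega> \<in> space P. tp_recovers J N (card \<Omega>) M (\<lambda>j. \<Phi> j \<omega>) (\<lambda>j. x j \<omega>)}"
  proof (rule finite_measure_mono_AE)
    \<comment> \<open>Off the bad events the selected support is right, but the systems on it are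
      uniquely solvable only up to null sets, finitely many for fixed \<open>J\<close>. The two
      events are therefore compared almost everywhere.\<close>
    have "AE \<omega> in P. \<forall>j\<in>{1..J}. Determinant.det (column_mat (\<Phi> j \<omega>) \<Omega>) \<noteq> 0"
      using M by (intro AE_finite_allI AE_det_support_neq_0) auto
    then show "AE \<omega> in P. \<omega> \<in> space P - (\<Union>p\<in>?I. bad p) \<longrightarrow>
        \<omega> \<in> {\<omega> \<in> space P. tp_recovers J N (card \<Omega>) M (\<lambda>j. \<Phi> j \<omega>) (\<lambda>j. x j \<omega>)}"
    proof eventually_elim
      case (elim \<omega>)
      show ?case
      proof
        assume \<omega>: "\<omega> \<in> space P - (\<Union>p\<in>?I. bad p)"
        have gap: "stat \<omega> k < stat \<omega> n" if "n \<in> \<Omega>" "k \<in> {1..N} - \<Omega>" for n k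
        proof -
          have "\<omega> \<notin> bad (n, k)"
            using \<omega> that by blast
          then have "0 < (\<Sum>j=1..J. diff_stat n k j \<omega>)"
            using \<omega> by (auto simp: bad_def)
          then have "0 < stat \<omega> n - stat \<omega> k"
            using stat_diff[of \<omega> n k] \<omega> \<open>J \<ge> 1\<close> by simp
          then show ?thesis
            by simp
        qed
        have "tp_recovers J N (card \<Omega>) M (\<lambda>j. \<Phi> j \<omega>) (\<lambda>j. x j \<omega>)"
        proof (subst tp_recovers_iff[OF _ M]; (intro ballI impI)?)
          fix S j
          assume "S \<in> {S \<in> Pow {1..N}. card S = card \<Omega>}"
            "\<forall>n\<in>S. \<forall>k\<in>{1..N} - S. stat \<omega> k \<le> stat \<omega> n"
          then have "S = \<Omega>"
            by (intro tp_support_unique[OF finite_\<Omega> refl \<Omega>_subset gap]) (auto simp: tp_support_def)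
          moreover assume "j \<in> {1..J}"
          ultimately show "(\<forall>n\<in>\<Omega> - S. x j \<omega> n = 0) \<and> Determinant.det (column_mat (\<Phi> j \<omega>) S) \<noteq> 0"
            using elim by blast
        qed (use \<omega> in auto)
        then show "\<omega> \<in> {\<omega> \<in> space P. tp_recovers J N (card \<Omega>) M (\<lambda>j. \<Phi> j \<omega>) (\<lambda>j. x j \<omega>)}"
          using \<omega> by simp
      qed
    qed
    show "{\<omega> \<in> space P. tp_recovers J N (card \<Omega>) M (\<lambda>j. \<Phi> j \<omega>) (\<lambda>j. x j \<omega>)} \<in> events"
      by (rule tp_recovers_measurable[OF M])
  qed
  ultimately show ?thesis
    by linarith
qed

end

section \<open>The limit in \<open>J\<close>, and non-uniqueness for every \<open>J\<close>\<close>

theorem corollary2: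
  fixes N K :: nat and \<Omega> :: "nat set" and \<sigma> :: real and M :: "nat \<Rightarrow> nat"
    and P :: "nat \<Rightarrow> 'a measure"
    and x :: "nat \<Rightarrow> nat \<Rightarrow> 'a \<Rightarrow> nat \<Rightarrow> real"
    and \<Phi> :: "nat \<Rightarrow> nat \<Rightarrow> 'a \<Rightarrow> nat \<Rightarrow> nat \<Rightarrow> real"
  assumes "\<Omega> \<subseteq> {1..N}" and "card \<Omega> = K" and "\<sigma> > 0"
    and "\<And>J. jsm2_ensemble (P J) J N \<Omega> \<sigma> M (x J) (\<Phi> J)"
  shows
    "(\<forall>\<tau>>0. (\<forall>j\<ge>1. M j = K) \<and>
        (\<forall>J. \<forall>j\<in>{1..J}. iid_gaussian (P J) \<tau> ({1..M j} \<times> {1..N}) (\<lambda>(m, n) \<omega>. \<Phi> J j \<omega> m n)) \<longrightarrow>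
        (\<lambda>J. measure (P J)
           {\<omega> \<in> space (P J). tp_recovers J N K M (\<lambda>j. \<Phi> J j \<omega>) (\<lambda>j. x J j \<omega>)}) \<longlonglongrightarrow> 1)
     \<and>
     (\<forall>J. \<forall>j\<in>{1..J}. M j < K \<longrightarrow>
        (AE \<omega> in P J. \<exists>x' \<Omega>'.
           \<Omega>' \<subseteq> {1..N} \<and> card \<Omega>' = K \<and>
           (\<forall>i\<in>{1..J}. {n. x' i n \<noteq> 0} = \<Omega>') \<and>
           x' j \<noteq> x J j \<omega> \<and>
           (\<forall>i\<in>{1..J}. \<forall>m\<in>{1..M i}.
              measure_vec N (\<Phi> J i \<omega>) (x' i) m = measure_vec N (\<Phi> J i \<omega>) (x J i \<omega>) m)))"
proof (intro conjI allI ballI impI)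
  fix \<tau> :: real
  assume "\<tau> > 0"
  assume *: "(\<forall>j\<ge>1. M j = K) \<and>
    (\<forall>J. \<forall>j\<in>{1..J}. iid_gaussian (P J) \<tau> ({1..M j} \<times> {1..N}) (\<lambda>(m, n) \<omega>. \<Phi> J j \<omega> m n))"
  have gauss: "gaussian_ensemble (P J) J N \<Omega> \<sigma> \<tau> M (x J) (\<Phi> J)" for J
  proof (intro gaussian_ensemble.intro gaussian_ensemble_axioms.intro)
    show "prob_space (P J)"
      using assms(4)[of J] by (simp add: jsm2_ensemble_def)
  qed (use assms * \<open>\<tau> > 0\<close> in blast)+
  define p where "p J = measure (P J)
    {\<omega> \<in> space (P J). tp_recovers J N K M (\<lambda>j. \<Phi> J j \<omega>) (\<lambda>j. x J j \<omega>)}" for J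
  define a where "a = real (card (\<Omega> \<times> ({1..N} - \<Omega>)))"
  define b where "b = 2 * real (K * K) ^ 4 * (gaussian_moment12 \<sigma> + 2 * gaussian_moment12 \<tau>)"
  define c where "c = (2 * \<sigma>\<^sup>2 * real K * \<tau> ^ 4)\<^sup>2"
  have lower: "1 - a * (b / (real J * c)) \<le> p J" if "J \<ge> 1" for J
    using gaussian_ensemble.prob_tp_recovers_ge[OF gauss[of J] _ that] * assms(2)
    unfolding p_def a_def b_def c_def by simp
  have upper: "p J \<le> 1" for J
    using assms(4)[of J] by (simp add: p_def jsm2_ensemble_def prob_space.prob_le_1)
  have "p \<longlonglongrightarrow> 1"
  proof (rule tendsto_sandwich)
    show "\<forall>\<^sub>F J in sequentially. 1 - a * (b / (real J * c)) \<le> p J"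
      using eventually_ge_at_top[of 1] by eventually_elim (rule lower)
    \<comment> \<open>For \<open>K = 0\<close> both \<open>a\<close> and \<open>c\<close> are 0, and
      division by zero yields 0, so this form covers that case as well.\<close>
    have "(\<lambda>J. 1 - a * b / c * (1 / real J)) \<longlonglongrightarrow> 1 - a * b / c * 0"
      by (intro tendsto_intros lim_1_over_n)
    then show "(\<lambda>J. 1 - a * (b / (real J * c))) \<longlonglongrightarrow> 1"
      by (simp add: mult.commute)
  qed (use upper in auto)
  then show "(\<lambda>J. measure (P J)
      {\<omega> \<in> space (P J). tp_recovers J N K M (\<lambda>j. \<Phi> J j \<omega>) (\<lambda>j. x J j \<omega>)}) \<longlonglongrightarrow> 1"
    by (simp add: p_def[abs_def])
next
  fix J j assume j: "j \<in> {1..J}" "M j < K"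
  have "prob_space (P J)"
    using assms(4)[of J] by (simp add: jsm2_ensemble_def)
  then show "AE \<omega> in P J. \<exists>x' \<Omega>'. \<Omega>' \<subseteq> {1..N} \<and> card \<Omega>' = K \<and>
      (\<forall>i\<in>{1..J}. {n. x' i n \<noteq> 0} = \<Omega>') \<and> x' j \<noteq> x J j \<omega> \<and>
      (\<forall>i\<in>{1..J}. \<forall>m\<in>{1..M i}.
        measure_vec N (\<Phi> J i \<omega>) (x' i) m = measure_vec N (\<Phi> J i \<omega>) (x J i \<omega>) m)"
    using prob_space.AE_another_ensemble[OF _ assms(1) assms(4) j(1)] j(2) assms(2) by simp
qed

end
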